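(* Let $D\subset\mathbb{C}^n$, $n>1$, be a domain with $C^2$-smooth boundary, let $\xi\in\partial D$, and let $f$ be a holomorphic function in $D$ which has a limit (in $\overline{\mathbb{C}}=\mathbb{C}\cup\{\infty\}$) along the normal to $\partial D$ at $\xi$. Then $f$ has an admissible limit at $\xi$ if and only if in every admissible domain with vertex $\xi$ the spherical derivatives of $f$ in the normal and complex tangent directions increase like $o(1/d(z))$ and $o(1/\sqrt{d(z)})$, respectively; that is, if and only if for every $\alpha>0$ $$d(z)\,\frac{\big|\frac{\partial f}{\partial\widetilde z_1}(z)\big|}{1+|f(z)|^2}\to0\quad\text{and}\quad \sqrt{d(z)}\,\frac{\big|\frac{\partial f}{\partial\widetilde z_\mu}(z)\big|}{1+|f(z)|^2}\to0\quad(\mu=2,\ldots,n)$$ as $z\to\xi$, $z\in A_\alpha(\xi)$.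
   Context: Let $\nu_\xi$ be the unit outward normal vector to $\partial D$ at $\xi$. A function $f$ on $D$ has limit $L\in\overline{\mathbb{C}}=\mathbb{C}\cup\{\infty\}$ along the normal $\nu_\xi$ at $\xi$ if $\lim_{t\to0^+}f(\xi-t\nu_\xi)=L$. Coordinates at $\xi$. After a translation and a unitary transformation of $\mathbb{C}^n$ assume $\xi=0$, the inner normal to $\partial D$ at $0$ points in the positive $x_1$ direction, and the complex tangent space to $\partial D$ at $0$ is $\{z: z_1=0\}$. Write $z_j=x_j+iy_j$ and identify $z$ with $(x_1,\zeta)$, $\zeta=(y_1,x_2,y_2,\ldots,x_n,y_n)\in\mathbb{R}^{2n-1}$. There is a real-valued $C^2$ function $\psi$ with $\psi(0)=0$, $\nabla\psi(0)=0$ (real gradient) such that, in a neighbourhood of $\overline V$, where $V$ is a fixed sufficiently small bounded open neighbourhood of $0$, $D$ is given by $x_1>\psi(\zeta)$ and $\partial D$ by $x_1=\psi(\zeta)$. All considerations are local, i.e. for $z\in D\cap V$; $V$ is also taken so small that each $z\in D\cap V$ has a unique closest point $\zeta(z)\in\partial D$. Set $d(z)=\min\{x_1,\,x_1-\psi(\zeta)\}$ and, for $\alpha>0$, define the admissible domain with vertex $\xi=0$ by $$A_\alpha(\xi)=\{z\in D\cap V:\ |z|^2<\alpha\, d(z),\ |y_1|<\alpha x_1\}.$$ A function $f$ has an admissible limit $L\in\overline{\mathbb{C}}$ at $\xi$ if, for every $\alpha>0$, $f(z)\to L$ as $z\to\xi$, $z\in A_\alpha(\xi)$ (the value $L=\infty$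 is allowed). Spherical derivatives. For each $z\in D\cap V$ choose coordinates $\widetilde z_1,\ldots,\widetilde z_n$ on $\mathbb{C}^n$, obtained from the standard ones by a translation and a unitary transformation (depending on $z$), such that $\zeta(z)$ becomes the origin, the $\widetilde z_1$-axis $\{(\widetilde z_1,0,\ldots,0)\}$ is the complex normal space to $\partial D$ at $\zeta(z)$ (with the normal direction equal to $(1,0,\ldots,0)$), and $\{(0,\widetilde z_2,\ldots,\widetilde z_n)\}$ is the complex tangent space to $\partial D$ at $\zeta(z)$. The quantities $\big|\frac{\partial f}{\partial\widetilde z_1}(z)\big|/(1+|f(z)|^2)$ and $\big|\frac{\partial f}{\partial\widetilde z_\mu}(z)\big|/(1+|f(z)|^2)$, $\mu=2,\ldots,n$, where the derivatives at $z$ are taken in the coordinates chosen for that $z$, are called the spherical derivatives of $f$ at $z$ in the normal and complex tangent directions, respectively. *)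

theory Defs
  imports "HOL-Analysis.Analysis"
begin

text \<open>
  Points of complex \<open>n\<close>-space are vectors of type \<open>complex ^ 'n\<close>; the real inner product of
  this type is the real part of the Hermitian one. An index \<open>i0 :: 'n\<close> plays the role
  of the first coordinate, and the other indices that of \<open>2, \<dots>, n\<close>.
\<close>

definition holomorphic_Cn_on :: "(complex ^ 'n \<Rightarrow> complex) \<Rightarrow> (complex ^ 'n) set \<Rightarrow> bool" where
  "holomorphic_Cn_on f D \<longleftrightarrow>
    (\<forall>z\<in>D. \<exists>f'. (f has_derivative f') (at z) \<and> (\<forall>c v. f' (c *s v) = c * f' v))"

definition complex_partial :: "(complex ^ 'n \<Rightarrow> complex) \<Rightarrow> 'n \<Rightarrow> complex ^ 'n \<Rightarrow> complex" where
  "complex_partial g \<mu> p = deriv (\<lambda>t. g (\<chi> i. if i = \<mu> then t else p $ i)) (p $ \<mu>)"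

text \<open>Values and limits in the Riemann sphere; \<open>None\<close> is the point at infinity.\<close>

definition tendsto_sphere :: "('a \<Rightarrow> complex) \<Rightarrow> complex option \<Rightarrow> 'a filter \<Rightarrow> bool" where
  "tendsto_sphere f L F \<longleftrightarrow>
    (case L of Some l \<Rightarrow> (f \<longlongrightarrow> l) F | None \<Rightarrow> filterlim f at_infinity F)"

text \<open>\<open>G\<close> is the gradient of \<open>r\<close>, and \<open>H\<close> the derivative of the gradient (the Hessian).\<close>

definition C2_on :: "('a::euclidean_space \<Rightarrow> real) \<Rightarrow> 'a set \<Rightarrow> bool" where
  "C2_on r S \<longleftrightarrow>
    (\<exists>(G :: 'a \<Rightarrow> 'a) (H :: 'a \<Rightarrow> 'a \<Rightarrow>\<^sub>L 'a).
       (\<forall>x\<in>S. GDERIV r x :> G x \<and> (G has_derivative blinfun_apply (H x)) (at x)) \<and>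
       continuous_on S H)"

definition local_defining_function ::
  "'a::euclidean_space set \<Rightarrow> 'a \<Rightarrow> 'a set \<Rightarrow> ('a \<Rightarrow> real) \<Rightarrow> bool" where
  "local_defining_function D p N r \<longleftrightarrow>
     open N \<and> p \<in> N \<and> C2_on r N \<and>
     D \<inter> N = {z\<in>N. r z < 0} \<and>
     frontier D \<inter> N = {z\<in>N. r z = 0} \<and>
     (\<forall>z\<in>frontier D \<inter> N. \<not> GDERIV r z :> 0)"

definition C2_boundary :: "'a::euclidean_space set \<Rightarrow> bool" where
  "C2_boundary D \<longleftrightarrow> (\<forall>p\<in>frontier D. \<exists>N r. local_defining_function D p N r)"

definition outward_unit_normal :: "'a::euclidean_space set \<Rightarrow> 'a \<Rightarrow> 'a \<Rightarrow> bool" where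
  "outward_unit_normal D p \<nu> \<longleftrightarrow>
     (\<exists>N r g. local_defining_function D p N r \<and> GDERIV r p :> g \<and> \<nu> = g /\<^sub>R norm g)"

text \<open>
  The complex normal and tangent spaces of a hypersurface, as linear subspaces, in terms of a
  nonzero real normal vector: the complex line spanned by it, and the largest complex
  subspace of the real tangent space.
\<close>

definition complex_normal_space :: "complex ^ 'n \<Rightarrow> (complex ^ 'n) set" where
  "complex_normal_space \<nu> = {c *s \<nu> | c. True}"

definition complex_tangent_space :: "complex ^ 'n \<Rightarrow> (complex ^ 'n) set" where
  "complex_tangent_space \<nu> = {v. v \<bullet> \<nu> = 0 \<and> (\<i> *s v) \<bullet> \<nu> = 0}"

definition adjoint_matrix :: "complex ^ 'n ^ 'n \<Rightarrow> complex ^ 'n ^ 'n" where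
  "adjoint_matrix W = map_matrix cnj (transpose W)"

definition unitary_matrix :: "complex ^ 'n ^ 'n \<Rightarrow> bool" where
  "unitary_matrix W \<longleftrightarrow> W ** adjoint_matrix W = mat 1 \<and> adjoint_matrix W ** W = mat 1"

text \<open>
  A point \<open>p\<close> and a unitary matrix \<open>W\<close> give new coordinates \<open>w\<close> with origin \<open>p\<close> through
  \<open>z = p + W w\<close>. The matrix is adapted to a unit normal \<open>\<nu>\<close> if \<open>\<nu>\<close> gets the coordinates
  \<open>(1, 0, \<dots>, 0)\<close>, the complex normal space becomes the first coordinate axis, and the complex
  tangent space becomes the set where the first coordinate vanishes.
\<close>

definition from_coords :: "complex ^ 'n \<Rightarrow> complex ^ 'n ^ 'n \<Rightarrow> complex ^ 'n \<Rightarrow> complex ^ 'n" where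
  "from_coords p W w = p + W *v w"

definition to_coords :: "complex ^ 'n \<Rightarrow> complex ^ 'n ^ 'n \<Rightarrow> complex ^ 'n \<Rightarrow> complex ^ 'n" where
  "to_coords p W z = adjoint_matrix W *v (z - p)"

definition adapted_frame :: "'n \<Rightarrow> complex ^ 'n \<Rightarrow> complex ^ 'n ^ 'n \<Rightarrow> bool" where
  "adapted_frame i0 \<nu> W \<longleftrightarrow>
     unitary_matrix W \<and> W *v axis i0 1 = \<nu> \<and>
     (\<lambda>w. W *v w) ` {w. \<forall>\<mu>. \<mu> \<noteq> i0 \<longrightarrow> w $ \<mu> = 0} = complex_normal_space \<nu> \<and>
     (\<lambda>w. W *v w) ` {w. w $ i0 = 0} = complex_tangent_space \<nu>"

text \<open>
  The real coordinates \<open>\<zeta> = (y\<^sub>1, x\<^sub>2, y\<^sub>2, \<dots>, x\<^sub>n, y\<^sub>n)\<close> are encoded as the vector whose first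
  component has real part zero; functions of \<open>\<zeta>\<close> are only ever evaluated at such vectors.
\<close>

definition zeta_part :: "'n \<Rightarrow> complex ^ 'n \<Rightarrow> complex ^ 'n" where
  "zeta_part i0 w = (\<chi> i. if i = i0 then Complex 0 (Im (w $ i)) else w $ i)"

text \<open>
  Near the closure of \<open>V\<close>, in the coordinates at \<open>\<xi>\<close> given by \<open>W\<close>, the set \<open>D\<close> is
  \<open>x\<^sub>1 > \<psi> \<zeta>\<close>. Since \<open>w \<mapsto> \<psi> (zeta_part i0 w)\<close> does not depend on \<open>x\<^sub>1\<close>, its smoothness and
  its gradient are those of \<open>\<psi>\<close> as a function of \<open>\<zeta>\<close>. The last clause says that each
  point of \<open>D \<inter> V\<close> has a unique closest boundary point, which is then given
  by \<^const>\<open>closest_point\<close>.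
\<close>

definition graph_neighbourhood ::
  "'n \<Rightarrow> (complex ^ 'n) set \<Rightarrow> complex ^ 'n \<Rightarrow> complex ^ 'n ^ 'n \<Rightarrow> (complex ^ 'n \<Rightarrow> real)
    \<Rightarrow> (complex ^ 'n) set \<Rightarrow> bool" where
  "graph_neighbourhood i0 D \<xi> W \<psi> V \<longleftrightarrow>
     open V \<and> bounded V \<and> \<xi> \<in> V \<and>
     \<psi> 0 = 0 \<and> GDERIV (\<lambda>w. \<psi> (zeta_part i0 w)) 0 :> 0 \<and>
     (\<exists>N. open N \<and> closure V \<subseteq> N \<and>
        C2_on (\<lambda>w. \<psi> (zeta_part i0 w)) (to_coords \<xi> W ` N) \<and>
        (\<forall>z\<in>N. let w = to_coords \<xi> W z in
           (z \<in> D \<longleftrightarrow> Re (w $ i0) > \<psi> (zeta_part i0 w)) \<and>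
           (z \<in> frontier D \<longleftrightarrow> Re (w $ i0) = \<psi> (zeta_part i0 w)))) \<and>
     (\<forall>z\<in>D \<inter> V. \<exists>!p. p \<in> frontier D \<and> (\<forall>q\<in>frontier D. dist z p \<le> dist z q))"

definition boundary_d ::
  "'n \<Rightarrow> complex ^ 'n \<Rightarrow> complex ^ 'n ^ 'n \<Rightarrow> (complex ^ 'n \<Rightarrow> real) \<Rightarrow> complex ^ 'n \<Rightarrow> real" where
  "boundary_d i0 \<xi> W \<psi> z =
     (let w = to_coords \<xi> W z in min (Re (w $ i0)) (Re (w $ i0) - \<psi> (zeta_part i0 w)))"

definition admissible_domain ::
  "'n \<Rightarrow> (complex ^ 'n) set \<Rightarrow> complex ^ 'n \<Rightarrow> complex ^ 'n ^ 'n \<Rightarrow> (complex ^ 'n \<Rightarrow> real)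
    \<Rightarrow> (complex ^ 'n) set \<Rightarrow> real \<Rightarrow> (complex ^ 'n) set" where
  "admissible_domain i0 D \<xi> W \<psi> V \<alpha> =
     {z \<in> D \<inter> V. let w = to_coords \<xi> W z in
        (norm w)\<^sup>2 < \<alpha> * boundary_d i0 \<xi> W \<psi> z \<and> \<bar>Im (w $ i0)\<bar> < \<alpha> * Re (w $ i0)}"

definition has_normal_limit ::
  "(complex ^ 'n \<Rightarrow> complex) \<Rightarrow> complex ^ 'n \<Rightarrow> complex ^ 'n \<Rightarrow> complex option \<Rightarrow> bool" where
  "has_normal_limit f \<xi> \<nu> L \<longleftrightarrow> tendsto_sphere (\<lambda>t. f (\<xi> - t *\<^sub>R \<nu>)) L (at_right (0::real))"

definition has_admissible_limit ::
  "'n \<Rightarrow> (complex ^ 'n) set \<Rightarrow> complex ^ 'n \<Rightarrow> complex ^ 'n ^ 'n \<Rightarrow> (complex ^ 'n \<Rightarrow> real)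
    \<Rightarrow> (complex ^ 'n) set \<Rightarrow> (complex ^ 'n \<Rightarrow> complex) \<Rightarrow> complex option \<Rightarrow> bool" where
  "has_admissible_limit i0 D \<xi> W \<psi> V f L \<longleftrightarrow>
     (\<forall>\<alpha>>0. tendsto_sphere f L (at \<xi> within admissible_domain i0 D \<xi> W \<psi> V \<alpha>))"

text \<open>
  A choice, for each \<open>z\<close>, of coordinates centred at the boundary point closest to \<open>z\<close>. The first
  coordinate vector may be the outward or the inward unit normal there.
\<close>

definition moving_frame ::
  "'n \<Rightarrow> (complex ^ 'n) set \<Rightarrow> (complex ^ 'n) set \<Rightarrow> (complex ^ 'n \<Rightarrow> complex ^ 'n ^ 'n) \<Rightarrow> bool" where
  "moving_frame i0 D V F \<longleftrightarrow>
     (\<forall>z\<in>D \<inter> V. \<exists>\<nu>. outward_unit_normal D (closest_point (frontier D) z) \<nu> \<and>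
        (adapted_frame i0 \<nu> (F z) \<or> adapted_frame i0 (- \<nu>) (F z)))"

definition spherical_derivative ::
  "(complex ^ 'n) set \<Rightarrow> (complex ^ 'n \<Rightarrow> complex ^ 'n ^ 'n) \<Rightarrow> (complex ^ 'n \<Rightarrow> complex)
    \<Rightarrow> 'n \<Rightarrow> complex ^ 'n \<Rightarrow> real" where
  "spherical_derivative D F f \<mu> z =
     (let p = closest_point (frontier D) z in
        norm (complex_partial (f \<circ> from_coords p (F z)) \<mu> (to_coords p (F z) z))
          / (1 + (norm (f z))\<^sup>2))"

end

theory Submission
  imports Defs "HOL-Complex_Analysis.Cauchy_Integral_Formula"
begin

text \<open>
  If \<open>f\<close> has an admissible limit, then a point \<open>z\<close> of \<open>A\<^sub>\<alpha>\<close> is the centre of discs of radius about \<open>d z\<close>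
  in the normal direction and about \<open>sqrt (d z)\<close> in the complex tangent directions that stay in some
  \<open>A\<^sub>\<beta>\<close>, and Cauchy's estimate for \<open>f\<close> (or for \<open>1 / f\<close>) on these discs bounds the spherical
  derivatives. The frames at \<open>z\<close> and at \<open>\<xi>\<close> differ by \<open>O(norm (z - \<xi>)) = O(sqrt (d z))\<close>, so that it
  does not matter which of them defines the directions.

  Conversely, \<open>z = (x\<^sub>1, \<zeta>)\<close> in \<open>A\<^sub>\<alpha>\<close> is joined to the point \<open>(x\<^sub>1, 0)\<close> of the normal by the path
  \<open>(x\<^sub>1, t \<zeta>)\<close>, which stays in \<open>A\<^bsub>2\<alpha>\<^esub>\<close> because \<open>\<psi>\<close> is a quadratic form up to an error
  \<open>o(d z)\<close>. The velocity has normal component \<open>O(d)\<close> and tangential component \<open>O(sqrt d)\<close>, hence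
  the image of the path under \<open>f\<close> has spherical length tending to \<open>0\<close>.
\<close>

section \<open>The Riemann sphere\<close>

text \<open>With s = \<open>sphere_shadow a\<close> and h = \<open>sphere_height a\<close> one has
  |s|^2 + (h - 1/2)^2 = 1/4: together they are stereographic projection onto a sphere of diameter 1,
  with h measured from the pole that represents infinity. Both stay bounded, so finite and infinite
  limits can be treated alike.\<close>

definition sphere_height :: "complex \<Rightarrow> real" where
  "sphere_height a = 1 / (1 + (norm a)\<^sup>2)"

definition sphere_shadow :: "complex \<Rightarrow> complex" where
  "sphere_shadow a = a /\<^sub>R (1 + (norm a)\<^sup>2)"

lemma sphere_height_pos: "sphere_height a > 0"
  by (simp add: sphere_height_def add_pos_nonneg)

lemma one_plus_square_pos: "1 + (norm a)\<^sup>2 > 0" for a :: complex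
  by (simp add: add_pos_nonneg)

text \<open>A finite point is recovered as shadow divided by height, and this quotient is continuous
  because heights of finite points are nonzero.\<close>

lemma tendsto_sphere_Some_iff:
  "tendsto_sphere f (Some l) F \<longleftrightarrow>
    ((\<lambda>x. sphere_height (f x)) \<longlongrightarrow> sphere_height l) F \<and>
    ((\<lambda>x. sphere_shadow (f x)) \<longlongrightarrow> sphere_shadow l) F"
proof safe
  assume "tendsto_sphere f (Some l) F"
  then have f: "(f \<longlongrightarrow> l) F" by (simp add: tendsto_sphere_def)
  have pos: "1 + (norm l)\<^sup>2 \<noteq> 0" using one_plus_square_pos[of l] by linarith
  show "((\<lambda>x. sphere_height (f x)) \<longlongrightarrow> sphere_height l) F"
    unfolding sphere_height_def using pos by (intro tendsto_intros f)
  show "((\<lambda>x. sphere_shadow (f x)) \<longlongrightarrow> sphere_shadow l) F"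
    unfolding sphere_shadow_def using pos by (intro tendsto_intros f)
next
  assume h: "((\<lambda>x. sphere_height (f x)) \<longlongrightarrow> sphere_height l) F"
    and s: "((\<lambda>x. sphere_shadow (f x)) \<longlongrightarrow> sphere_shadow l) F"
  have eq: "sphere_shadow a /\<^sub>R sphere_height a = a" for a
    using one_plus_square_pos[of a] by (simp add: sphere_shadow_def sphere_height_def)
  have "((\<lambda>x. sphere_shadow (f x) /\<^sub>R sphere_height (f x)) \<longlongrightarrow>
      sphere_shadow l /\<^sub>R sphere_height l) F"
    using sphere_height_pos[of l] by (intro tendsto_intros s h) auto
  then show "tendsto_sphere f (Some l) F" by (simp add: eq tendsto_sphere_def)
qed

text \<open>The height alone decides here: |s|^2 = h - h^2 forces the shadow to vanish with
  it.\<close>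

lemma tendsto_sphere_None_iff:
  "tendsto_sphere f None F \<longleftrightarrow> ((\<lambda>x. sphere_height (f x)) \<longlongrightarrow> 0) F"
proof -
  have "tendsto_sphere f None F \<longleftrightarrow> filterlim (\<lambda>x. norm (f x)) at_top F"
    by (simp add: tendsto_sphere_def filterlim_at_infinity_conv_norm_at_top)
  also have "\<dots> \<longleftrightarrow> ((\<lambda>x. sphere_height (f x)) \<longlongrightarrow> 0) F"
  proof
    assume "filterlim (\<lambda>x. norm (f x)) at_top F"
    then have "filterlim (\<lambda>x. 1 + (norm (f x))\<^sup>2) at_top F"
      by (intro filterlim_tendsto_add_at_top[OF tendsto_const] filterlim_pow_at_top) auto
    then show "((\<lambda>x. sphere_height (f x)) \<longlongrightarrow> 0) F"
      unfolding sphere_height_def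
      by (intro tendsto_divide_0[OF tendsto_const] filterlim_at_top_imp_at_infinity)
  next
    assume lim: "((\<lambda>x. sphere_height (f x)) \<longlongrightarrow> 0) F"
    show "filterlim (\<lambda>x. norm (f x)) at_top F"
      unfolding filterlim_at_top_gt[where c = 0]
    proof (intro allI impI)
      fix Z :: real assume Z: "Z > 0"
      have "eventually (\<lambda>x. sphere_height (f x) < 1 / (1 + Z\<^sup>2)) F"
        using lim by (rule order_tendstoD) (use Z in \<open>simp add: add_pos_nonneg\<close>)
      then show "eventually (\<lambda>x. Z \<le> norm (f x)) F"
      proof eventually_elim
        case (elim x)
        then have "Z\<^sup>2 < (norm (f x))\<^sup>2"
          by (simp add: sphere_height_def divide_simps add_pos_nonneg)
        then show ?case using Z by (meson less_imp_le norm_ge_zero power2_less_imp_less)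
      qed
    qed
  qed
  finally show ?thesis .
qed

lemma tendsto_sphere_compose:
  assumes "tendsto_sphere f L G" and "filterlim g G F"
  shows "tendsto_sphere (\<lambda>x. f (g x)) L F"
  using assms by (auto simp: tendsto_sphere_def split: option.splits
      intro: filterlim_compose[where g = f and f = g])

text \<open>Carries a limit from one function to another whose stereographic coordinates differ from
  it by o(1), so that its users need not separate finite from infinite limits.\<close>

lemma tendsto_sphere_transfer:
  assumes "tendsto_sphere f L F"
    and "((\<lambda>x. sphere_height (g x) - sphere_height (f x)) \<longlongrightarrow> 0) F"
    and "((\<lambda>x. sphere_shadow (g x) - sphere_shadow (f x)) \<longlongrightarrow> 0) F"
  shows "tendsto_sphere g L F"
proof (cases L)
  case None
  then show ?thesis
    using assms(1) tendsto_add[OF assms(2), of "\<lambda>x. sphere_height (f x)" 0]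
    by (simp add: tendsto_sphere_None_iff)
next
  case (Some l)
  then show ?thesis
    using assms(1) tendsto_add[OF assms(2), of "\<lambda>x. sphere_height (f x)" "sphere_height l"]
      tendsto_add[OF assms(3), of "\<lambda>x. sphere_shadow (f x)" "sphere_shadow l"]
    by (simp add: tendsto_sphere_Some_iff)
qed

text \<open>The hypothesis bounds the speed in the spherical metric. The height has derivative at
  most 2|h||h'| / (1 + |h|^2)^2 \<le> \<epsilon> by 2|h| \<le> 1 + |h|^2, and the product rule for
  the shadow gives \<epsilon> + 2\<epsilon>. The mean value inequality on the unit interval does the
  rest.\<close>

lemma spherical_curve_bound:
  fixes h h' :: "real \<Rightarrow> complex"
  assumes der: "\<And>t. t \<in> {0..1} \<Longrightarrow> (h has_vector_derivative h' t) (at t within {0..1})"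
    and bound: "\<And>t. t \<in> {0..1} \<Longrightarrow> norm (h' t) / (1 + (norm (h t))\<^sup>2) \<le> \<epsilon>"
  shows "\<bar>sphere_height (h 1) - sphere_height (h 0)\<bar> \<le> \<epsilon>"
    and "norm (sphere_shadow (h 1) - sphere_shadow (h 0)) \<le> 3 * \<epsilon>"
proof -
  define m where "m t = 1 + (norm (h t))\<^sup>2" for t
  have m: "m t > 0" for t by (simp add: m_def one_plus_square_pos)
  \<comment> \<open>The derivative of \<open>1 / m\<close>, that is, of the height along the
    curve.\<close>
  define k where "k t = - (2 * (h t \<bullet> h' t)) / (m t)\<^sup>2" for t
  have h'_le: "norm (h' t) \<le> \<epsilon> * m t" if "t \<in> {0..1}" for t
    using bound[OF that] m[of t] by (simp add: m_def pos_divide_le_eq)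
  have sq: "2 * norm (h t) \<le> m t" "(norm (h t))\<^sup>2 \<le> m t" for t
    using zero_le_power2[of "norm (h t) - 1"] by (auto simp: m_def power2_diff)
  have inner_le: "\<bar>h t \<bullet> h' t\<bar> \<le> norm (h t) * (\<epsilon> * m t)" if "t \<in> {0..1}" for t
    using Cauchy_Schwarz_ineq2[of "h t" "h' t"] mult_left_mono[OF h'_le[OF that], of "norm (h t)"]
    by simp
  have eps: "\<epsilon> \<ge> 0" using h'_le[of 0] m[of 0] by (smt (verit) atLeastAtMost_iff norm_ge_zero zero_le_mult_iff)
  have k_le: "\<bar>k t\<bar> * m t \<le> 2 * norm (h t) * \<epsilon>" if "t \<in> {0..1}" for t
    using inner_le[OF that] m[of t]
    by (simp add: k_def abs_mult power2_eq_square divide_simps)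
  have derm: "(m has_real_derivative 2 * (h t \<bullet> h' t)) (at t within {0..1})" if "t \<in> {0..1}" for t
  proof -
    have "((\<lambda>t. 1 + h t \<bullet> h t) has_derivative (\<lambda>s. h t \<bullet> (s *\<^sub>R h' t) + (s *\<^sub>R h' t) \<bullet> h t))
        (at t within {0..1})"
      using der[OF that] unfolding has_vector_derivative_def
      by (auto intro!: derivative_eq_intros)
    then show ?thesis
      unfolding has_field_derivative_def m_def
      by (rule has_derivative_eq_rhs[THEN has_derivative_transform[rotated 2]])
         (use that in \<open>auto simp: power2_norm_eq_inner inner_commute fun_eq_iff\<close>)
  qed
  have derh: "((\<lambda>t. sphere_height (h t)) has_real_derivative k t) (at t within {0..1})"
    if "t \<in> {0..1}" for t
  proof -
    have "(\<lambda>t. sphere_height (h t)) = (\<lambda>t. inverse (m t))"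
      by (simp add: sphere_height_def m_def inverse_eq_divide)
    moreover have "- (2 * (h t \<bullet> h' t) * (inverse (m t) * inverse (m t))) = k t"
      by (simp add: k_def power2_eq_square divide_inverse)
    ultimately show ?thesis using DERIV_inverse_fun[OF derm[OF that]] m[of t] by simp
  qed
  have ders: "((\<lambda>t. sphere_shadow (h t)) has_vector_derivative
      (h' t /\<^sub>R m t + k t *\<^sub>R h t)) (at t within {0..1})" if "t \<in> {0..1}" for t
    using has_vector_derivative_scaleR[OF derh[OF that] der[OF that]]
    by (simp add: sphere_height_def sphere_shadow_def m_def inverse_eq_divide)
  have "norm (sphere_height (h 1) - sphere_height (h 0)) \<le> \<epsilon> * norm (1 - 0 :: real)"
  proof (rule differentiable_bound[where S = "{0..1}"])
    fix t :: real assume t: "t \<in> {0..1}"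
    have "\<bar>k t\<bar> * m t \<le> \<epsilon> * m t"
      using k_le[OF t] mult_right_mono[OF sq(1)[of t] eps] by (simp add: mult.commute)
    then have "\<bar>k t\<bar> \<le> \<epsilon>" using m[of t] by simp
    then show "onorm (\<lambda>s. k t * s) \<le> \<epsilon>"
      by (intro onorm_le) (simp add: abs_mult mult_right_mono)
  qed (use derh in \<open>auto simp: has_field_derivative_def\<close>)
  then show "\<bar>sphere_height (h 1) - sphere_height (h 0)\<bar> \<le> \<epsilon>" by simp
  have "norm (sphere_shadow (h 1) - sphere_shadow (h 0)) \<le> (3 * \<epsilon>) * norm (1 - 0 :: real)"
  proof (rule differentiable_bound[where S = "{0..1}"])
    fix t :: real assume t: "t \<in> {0..1}"
    have "\<bar>k t\<bar> * norm (h t) * m t \<le> 2 * \<epsilon> * (norm (h t))\<^sup>2"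
      using mult_right_mono[OF k_le[OF t], of "norm (h t)"]
      by (simp add: power2_eq_square algebra_simps)
    also have "\<dots> \<le> 2 * \<epsilon> * m t"
      using mult_left_mono[OF sq(2)[of t], of "2 * \<epsilon>"] eps by simp
    finally have "\<bar>k t\<bar> * norm (h t) \<le> 2 * \<epsilon>" using m[of t] by simp
    moreover have "norm (h' t) / m t \<le> \<epsilon>" using bound[OF t] by (simp add: m_def)
    moreover have "norm (h' t /\<^sub>R m t + k t *\<^sub>R h t) \<le> norm (h' t) / m t + \<bar>k t\<bar> * norm (h t)"
      using norm_triangle_ineq[of "h' t /\<^sub>R m t" "k t *\<^sub>R h t"] m[of t]
      by (simp add: divide_inverse mult.commute)
    ultimately have "norm (h' t /\<^sub>R m t + k t *\<^sub>R h t) \<le> 3 * \<epsilon>" by linarith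
    then show "onorm (\<lambda>s. s *\<^sub>R (h' t /\<^sub>R m t + k t *\<^sub>R h t)) \<le> 3 * \<epsilon>"
      by (intro onorm_le) (simp add: mult_left_mono mult.commute)
  qed (use ders in \<open>auto simp: has_vector_derivative_def\<close>)
  then show "norm (sphere_shadow (h 1) - sphere_shadow (h 0)) \<le> 3 * \<epsilon>" by simp
qed

text \<open>The radius \<open>1 / \<epsilon>\<close> at infinity is such that inversion maps this
  set into the disc of radius \<epsilon> about 0; hence the same \<epsilon> serves in Cauchy's
  estimate for a function and for its reciprocal.\<close>

definition sphere_nbhd :: "complex option \<Rightarrow> real \<Rightarrow> complex set" where
  "sphere_nbhd L \<epsilon> = (case L of Some l \<Rightarrow> ball l \<epsilon> | None \<Rightarrow> {a. norm a > 1 / \<epsilon>})"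

lemma tendsto_sphere_nbhd:
  assumes "tendsto_sphere f L F" and "\<epsilon> > 0"
  shows "eventually (\<lambda>x. f x \<in> sphere_nbhd L \<epsilon>) F"
proof (cases L)
  case None
  then have "filterlim (\<lambda>x. norm (f x)) at_top F"
    using assms by (simp add: tendsto_sphere_def filterlim_at_infinity_conv_norm_at_top)
  then show ?thesis using None by (simp add: sphere_nbhd_def filterlim_at_top_dense)
next
  case (Some l)
  then show ?thesis
    using assms by (simp add: sphere_nbhd_def tendsto_sphere_def tendsto_iff dist_commute)
qed

section \<open>Cauchy estimates for spherical derivatives\<close>

lemma Cauchy_estimate_cball:
  fixes h :: "complex \<Rightarrow> complex"
  assumes "R > 0" and "\<And>s. s \<in> cball 0 R \<Longrightarrow> h field_differentiable (at s)"
    and "\<And>s. s \<in> cball 0 R \<Longrightarrow> norm (h s - a) \<le> \<epsilon>"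
  shows "R * norm (deriv h 0) \<le> \<epsilon>"
proof -
  have hol: "(\<lambda>s. h s - a) holomorphic_on cball 0 R"
    unfolding holomorphic_on_def
    by (auto intro!: field_differentiable_diff field_differentiable_at_within[OF assms(2)])
  have "norm ((deriv ^^ 1) (\<lambda>s. h s - a) 0) \<le> fact 1 * \<epsilon> / R ^ 1"
    by (rule Cauchy_inequality)
      (use assms holomorphic_on_subset[OF hol ball_subset_cball]
        holomorphic_on_imp_continuous_on[OF hol] in auto)
  moreover have "deriv (\<lambda>s. h s - a) 0 = deriv h 0"
    using assms(1,2) by (subst deriv_diff) auto
  ultimately show ?thesis using \<open>R > 0\<close> by (simp add: field_simps)
qed

text \<open>At infinity the estimate is applied to \<open>1 / h\<close>, which has the same spherical derivative.\<close>

lemma spherical_Cauchy_estimate: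
  fixes h :: "complex \<Rightarrow> complex"
  assumes R: "R > 0" and \<epsilon>: "\<epsilon> > 0"
    and diff: "\<And>s. s \<in> cball 0 R \<Longrightarrow> h field_differentiable (at s)"
    and vals: "\<And>s. s \<in> cball 0 R \<Longrightarrow> h s \<in> sphere_nbhd L \<epsilon>"
  shows "R * (norm (deriv h 0) / (1 + (norm (h 0))\<^sup>2)) \<le> \<epsilon>"
proof (cases L)
  case (Some l)
  have "R * norm (deriv h 0) \<le> \<epsilon>"
    using vals Some
    by (intro Cauchy_estimate_cball[OF R diff, of l])
       (auto simp: sphere_nbhd_def dist_norm norm_minus_commute intro: less_imp_le)
  \<comment> \<open>For a finite limit the plain derivative suffices, because the denominator is at
    least 1.\<close>
  moreover have "norm (deriv h 0) / (1 + (norm (h 0))\<^sup>2) \<le> norm (deriv h 0)"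
    by (simp add: divide_le_eq one_plus_square_pos algebra_simps)
  ultimately show ?thesis using R by (meson less_imp_le mult_left_mono order_trans)
next
  case None
  have big: "norm (h s) > 1 / \<epsilon>" and nz: "h s \<noteq> 0" if "s \<in> cball 0 R" for s
    using vals[OF that] None \<epsilon> by (auto simp: sphere_nbhd_def)
  have h0: "h 0 \<noteq> 0" "h field_differentiable at 0" using nz[of 0] diff[of 0] R by auto
  have "R * norm (deriv (\<lambda>s. inverse (h s)) 0) \<le> \<epsilon>"
  proof (rule Cauchy_estimate_cball[OF R, of _ 0])
    fix s :: complex assume s: "s \<in> cball 0 R"
    show "(\<lambda>s. inverse (h s)) field_differentiable at s"
      using diff[OF s] nz[OF s] by (rule field_differentiable_inverse)
    show "norm (inverse (h s) - 0) \<le> \<epsilon>"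
      using big[OF s] nz[OF s] \<epsilon> by (simp add: norm_inverse norm_divide field_simps)
  qed
  moreover have "deriv (\<lambda>s. inverse (h s)) 0 = - deriv h 0 / (h 0)\<^sup>2"
    using h0 by (intro DERIV_imp_deriv)
      (auto intro!: derivative_eq_intros simp: DERIV_deriv_iff_field_differentiable
        power2_eq_square divide_inverse)
  \<comment> \<open>Dropping the 1 leaves exactly the modulus of the derivative of
    \<open>1 / h\<close> at 0.\<close>
  moreover have "norm (deriv h 0) / (1 + (norm (h 0))\<^sup>2) \<le> norm (deriv h 0) / (norm (h 0))\<^sup>2"
    using h0 by (intro divide_left_mono) (auto intro!: mult_pos_pos simp: add_pos_nonneg)
  ultimately show ?thesis
    using mult_left_mono[of "norm (deriv h 0) / (1 + (norm (h 0))\<^sup>2)" _ R] R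
    by (fastforce simp: norm_divide norm_power)
qed

section \<open>Unitary frames and normals\<close>

text \<open>Conjugation sits in the first argument, so that pairing with a unit axis vector on the
  left reads off a coordinate.\<close>

definition hprod :: "complex ^ 'n \<Rightarrow> complex ^ 'n \<Rightarrow> complex" where
  "hprod a b = (\<Sum>i\<in>UNIV. cnj (a $ i) * b $ i)"

lemma Re_hprod: "Re (hprod a b) = a \<bullet> b"
  by (simp add: hprod_def inner_vec_def inner_complex_def)

lemma norm_hprod_le: "norm (hprod a b) \<le> norm a * norm b"
proof -
  have "norm (hprod a b) \<le> (\<Sum>i\<in>UNIV. \<bar>norm (a $ i)\<bar> * \<bar>norm (b $ i)\<bar>)"
    unfolding hprod_def by (rule order_trans[OF norm_sum]) (simp add: norm_mult)
  also have "\<dots> \<le> norm a * norm b"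
    unfolding norm_vec_def by (rule L2_set_mult_ineq)
  finally show ?thesis .
qed

lemma hprod_diff_left: "hprod (a - b) c = hprod a c - hprod b c"
  and hprod_minus_left: "hprod (- a) c = - hprod a c"
  by (simp_all add: hprod_def algebra_simps sum_subtractf sum_negf)

lemma sum_if_eq_times:
  fixes c :: "'a::comm_semiring_1"
  shows "(\<Sum>j\<in>UNIV. (if j = i then c else 0) * x j) = c * x (i :: 'n::finite)"
proof -
  have "(\<Sum>j\<in>UNIV. (if j = i then c else 0) * x j) = (\<Sum>j\<in>UNIV. if j = i then c * x j else 0)"
    by (rule sum.cong) auto
  then show ?thesis by simp
qed

lemma hprod_axis: "hprod (axis i 1) b = b $ i"
proof -
  have "cnj (axis i 1 $ j) = (if j = i then 1 else 0)" for j by (simp add: axis_def)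
  then show ?thesis by (simp add: hprod_def sum_if_eq_times)
qed

lemma hprod_adjoint: "hprod (adjoint_matrix M *v a) b = hprod a (M *v b)"
proof -
  have "hprod (adjoint_matrix M *v a) b = (\<Sum>i\<in>UNIV. \<Sum>j\<in>UNIV. M $ j $ i * cnj (a $ j) * b $ i)"
    by (simp add: hprod_def adjoint_matrix_def matrix_vector_mult_def map_matrix_def transpose_def
        sum_distrib_right)
  also have "\<dots> = (\<Sum>j\<in>UNIV. \<Sum>i\<in>UNIV. M $ j $ i * cnj (a $ j) * b $ i)"
    by (rule sum.swap)
  also have "\<dots> = hprod a (M *v b)"
    by (simp add: hprod_def matrix_vector_mult_def sum_distrib_left mult_ac)
  finally show ?thesis .
qed

section \<open>Unitary matrices and the coordinate changes they define\<close>

lemma adjoint_adjoint: "adjoint_matrix (adjoint_matrix M) = M"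
  by (simp add: adjoint_matrix_def map_matrix_def transpose_def vec_eq_iff)

lemma adjoint_matrix_mul: "adjoint_matrix (A ** B) = adjoint_matrix B ** adjoint_matrix A"
  by (simp add: adjoint_matrix_def map_matrix_def transpose_def vec_eq_iff matrix_matrix_mult_def
      mult.commute)

lemma unitary_adjoint: "unitary_matrix M \<Longrightarrow> unitary_matrix (adjoint_matrix M)"
  by (simp add: unitary_matrix_def adjoint_adjoint)

lemma unitary_mul: "unitary_matrix A \<Longrightarrow> unitary_matrix B \<Longrightarrow> unitary_matrix (A ** B)"
  unfolding unitary_matrix_def adjoint_matrix_mul
  by (metis matrix_mul_assoc matrix_mul_lid)

lemma unitary_cancel:
  assumes "unitary_matrix M"
  shows "adjoint_matrix M *v (M *v x) = x" and "M *v (adjoint_matrix M *v x) = x"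
  using assms by (simp_all add: unitary_matrix_def matrix_vector_mul_assoc)

lemma unitary_inner: "unitary_matrix M \<Longrightarrow> (M *v x) \<bullet> (M *v y) = x \<bullet> y"
  by (metis Re_hprod hprod_adjoint unitary_cancel(1))

lemma unitary_norm: "unitary_matrix M \<Longrightarrow> norm (M *v x) = norm x"
  by (simp add: norm_eq_sqrt_inner unitary_inner)

lemma bounded_linear_matrix_vector: "bounded_linear (\<lambda>x. (M :: complex ^ 'n ^ 'm) *v x)"
proof -
  have "linear (\<lambda>x. M *v x)"
    by (rule linearI, rule matrix_vector_right_distrib)
       (simp add: matrix_vector_mult_def vec_eq_iff scaleR_sum_right)
  then show ?thesis by (rule linear_conv_bounded_linear[THEN iffD1])
qed

lemma matrix_vector_scaleR: "(M :: complex ^ 'n ^ 'm) *v (r *\<^sub>R x) = r *\<^sub>R (M *v x)"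
  using bounded_linear_matrix_vector linear_scale bounded_linear.linear by blast

lemma bounded_linear_vector_scalar: "bounded_linear (\<lambda>c. c *s (u :: complex ^ 'n))"
proof -
  have "linear (\<lambda>c. c *s u)"
    by (rule linearI) (simp_all add: vec_eq_iff algebra_simps)
  then show ?thesis by (rule linear_conv_bounded_linear[THEN iffD1])
qed

lemma to_coords_from_coords: "unitary_matrix W \<Longrightarrow> to_coords p W (from_coords p W w) = w"
  and from_coords_to_coords: "unitary_matrix W \<Longrightarrow> from_coords p W (to_coords p W z) = z"
  by (simp_all add: to_coords_def from_coords_def unitary_cancel)

lemma norm_to_coords: "unitary_matrix W \<Longrightarrow> norm (to_coords p W z) = dist z p"
  by (simp add: to_coords_def unitary_norm unitary_adjoint dist_norm)

lemma vector_expansion: "v = (\<Sum>i\<in>UNIV. (v $ i) *s axis i (1 :: 'a :: comm_semiring_1))"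
  by (simp add: vec_eq_iff axis_def if_distrib[of "\<lambda>x. _ * x"] cong: if_cong)

text \<open>The coordinate along the first frame vector is the Hermitian product of \<open>v\<close>
  with that vector, whose sign does not affect the modulus. Replacing \<open>n\<close> by
  \<open>axis i0 1\<close> costs an error bounded by Cauchy-Schwarz. This makes normal components in
  two nearby frames comparable.\<close>

lemma frame_first_component:
  assumes M: "unitary_matrix M" and first: "M *v axis i0 1 = n \<or> M *v axis i0 1 = - n"
  shows "norm ((adjoint_matrix M *v v) $ i0) \<le> norm (v $ i0) + norm v * norm (n - axis i0 1)"
    and "norm (v $ i0) \<le> norm ((adjoint_matrix M *v v) $ i0) + norm v * norm (n - axis i0 1)"
proof -
  have "(adjoint_matrix M *v v) $ i0 = hprod (M *v axis i0 1) v"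
    using hprod_adjoint[of "adjoint_matrix M" "axis i0 1" v]
    by (simp add: hprod_axis adjoint_adjoint)
  then have "norm ((adjoint_matrix M *v v) $ i0) = norm (hprod n v)"
    using first by (auto simp: hprod_minus_left)
  moreover have "hprod n v = v $ i0 + hprod (n - axis i0 1) v"
    by (simp add: hprod_diff_left hprod_axis)
  moreover have "norm (hprod (n - axis i0 1) v) \<le> norm v * norm (n - axis i0 1)"
    using norm_hprod_le[of "n - axis i0 1" v] by (simp add: mult.commute)
  ultimately show
    "norm ((adjoint_matrix M *v v) $ i0) \<le> norm (v $ i0) + norm v * norm (n - axis i0 1)"
    "norm (v $ i0) \<le> norm ((adjoint_matrix M *v v) $ i0) + norm v * norm (n - axis i0 1)"
    by (smt (verit) norm_triangle_ineq norm_triangle_ineq4 add_diff_cancel_right')+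
qed

section \<open>Normals at closest boundary points\<close>

lemma norm_sgn_diff_le:
  fixes x e :: "'a::real_normed_vector"
  assumes "norm e = 1"
  shows "norm (sgn x - e) \<le> 2 * norm (x - e)"
proof (cases "x = 0")
  case False
  \<comment> \<open>Normalising moves \<open>x\<close> by the difference of the norms of
    \<open>x\<close> and \<open>e\<close>, which is again at most |x - e|; hence the factor
    2.\<close>
  have "sgn x - x = (1 - norm x) *\<^sub>R sgn x"
    using False by (simp add: sgn_div_norm algebra_simps)
  then have "norm (sgn x - x) = \<bar>norm e - norm x\<bar>" using False assms by (simp add: norm_sgn)
  also have "\<dots> \<le> norm (x - e)" by (metis norm_triangle_ineq3 norm_minus_commute)
  finally show ?thesis using norm_triangle_ineq[of "sgn x - x" "x - e"] by simp
qed (use assms in auto)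

text \<open>Removing from \<open>a\<close> its projection onto \<open>b\<close> leaves a vector v
  orthogonal to \<open>b\<close>. A small positive multiple of \<open>b\<close> moves v into the
  open half-space, so v \<bullet> a \<le> 0 in the limit. But v \<bullet> v = v \<bullet> a, so v =
  0 and \<open>a\<close> is a negative multiple of \<open>b\<close>.\<close>

lemma halfspace_gradient:
  fixes a b :: "'a::real_inner"
  assumes half: "\<And>v. v \<bullet> b > 0 \<Longrightarrow> v \<bullet> a \<le> 0" and "a \<noteq> 0" "b \<noteq> 0"
  shows "sgn a = - sgn b"
proof -
  define v where "v = a - ((a \<bullet> b) / (b \<bullet> b)) *\<^sub>R b"
  have bb: "b \<bullet> b > 0" using \<open>b \<noteq> 0\<close> by simp
  have vb: "v \<bullet> b = 0" using bb by (simp add: v_def inner_diff_left)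
  have ba: "b \<bullet> a \<le> 0" using half bb by blast
  have "v \<bullet> a \<le> 0"
  proof (rule field_le_epsilon)
    fix \<epsilon> :: real assume "\<epsilon> > 0"
    \<comment> \<open>The divisor \<open>1 - b \<bullet> a\<close> is at least 1 and keeps the
      contribution of \<open>b\<close> to the product with \<open>a\<close> below
      \<epsilon>.\<close>
    have "(v + (\<epsilon> / (1 - b \<bullet> a)) *\<^sub>R b) \<bullet> a \<le> 0"
      using half[of "v + (\<epsilon> / (1 - b \<bullet> a)) *\<^sub>R b"] \<open>\<epsilon> > 0\<close> bb vb ba
      by (simp add: inner_add_left)
    then have "v \<bullet> a \<le> \<epsilon> * (- (b \<bullet> a) / (1 - b \<bullet> a))" by (simp add: inner_add_left)
    also have "\<dots> \<le> \<epsilon> * 1"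
      using ba \<open>\<epsilon> > 0\<close> by (intro mult_left_mono) (auto simp: field_simps)
    finally show "v \<bullet> a \<le> 0 + \<epsilon>" by simp
  qed
  moreover have "v \<bullet> v = v \<bullet> a"
    using vb unfolding v_def[of] by (simp add: inner_diff_right inner_commute)
  ultimately have "v = 0" by (metis inner_ge_zero inner_eq_zero_iff order_antisym)
  then have ab: "a = ((a \<bullet> b) / (b \<bullet> b)) *\<^sub>R b" by (simp add: v_def)
  moreover have "a \<bullet> b \<noteq> 0" using ab \<open>a \<noteq> 0\<close> by auto
  ultimately have "(a \<bullet> b) / (b \<bullet> b) < 0"
    using ba bb by (simp add: inner_commute divide_less_0_iff)
  then have "sgn (((a \<bullet> b) / (b \<bullet> b)) *\<^sub>R b) = - sgn b"
    by (simp only: sgn_scaleR sgn_neg scaleR_minus_left scaleR_one)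
  then show ?thesis using ab by simp
qed

text \<open>A direction with positive product against \<open>z - p\<close> leads from
  \<open>p\<close> into the ball, hence into \<open>D\<close>, where \<rho> is nonpositive; so
  \<rho> does not increase in that direction to first order, and \<open>halfspace_gradient\<close>
  applies. Any two functions with these sign conditions therefore have the same gradient direction
  at the touching point.\<close>

lemma interior_ball_normal:
  fixes p z a :: "'a::euclidean_space"
  assumes ball: "ball z (dist z p) \<subseteq> D" and "z \<noteq> p"
    and der: "GDERIV \<rho> p :> a" and "\<rho> p = 0" and "a \<noteq> 0"
    and N: "open N" "p \<in> N" and neg: "\<And>q. q \<in> N \<Longrightarrow> q \<in> D \<Longrightarrow> \<rho> q \<le> 0"
  shows "sgn a = - sgn (z - p)"
proof (rule halfspace_gradient)
  fix v assume v: "v \<bullet> (z - p) > 0"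
  have "((\<lambda>t. \<rho> (p + t *\<^sub>R v)) has_derivative (\<lambda>t. (t *\<^sub>R v) \<bullet> a)) (at 0)"
    using der unfolding gderiv_def
    by (intro has_derivative_compose[where f = "\<lambda>t. p + t *\<^sub>R v" and g = \<rho>, simplified])
      (auto intro!: derivative_eq_intros)
  then have d: "((\<lambda>t. \<rho> (p + t *\<^sub>R v)) has_real_derivative (v \<bullet> a)) (at 0)"
    by (simp add: has_field_derivative_def mult_commute_abs)
  show "v \<bullet> a \<le> 0"
  proof (rule ccontr)
    assume "\<not> v \<bullet> a \<le> 0"
    then obtain d1 where d1: "d1 > 0" "\<And>h. h > 0 \<Longrightarrow> h < d1 \<Longrightarrow> \<rho> (p + h *\<^sub>R v) > 0"
      using DERIV_pos_inc_right[OF d] \<open>\<rho> p = 0\<close> by auto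
    have "((\<lambda>h. p + h *\<^sub>R v) \<longlongrightarrow> p + 0 *\<^sub>R v) (at_right 0)"
      by (intro tendsto_intros)
    then have e1: "\<forall>\<^sub>F h in at_right 0. p + h *\<^sub>R v \<in> N"
      using N by (intro topological_tendstoD) auto
    have "((\<lambda>h. h * (v \<bullet> v)) \<longlongrightarrow> 0 * (v \<bullet> v)) (at_right 0)"
      by (intro tendsto_intros)
    then have e2: "\<forall>\<^sub>F h in at_right 0. h * (v \<bullet> v) < 2 * (v \<bullet> (z - p))"
      by (rule order_tendstoD) (use v in simp)
    have e3: "\<forall>\<^sub>F h in at_right 0. 0 < h \<and> h < d1"
      using eventually_at_right[of 0 d1] d1(1) by auto
    have "\<forall>\<^sub>F h in at_right (0::real). False"
      using e1 e2 e3
    proof eventually_elim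
      case (elim h)
      \<comment> \<open>For small h the linear gain outweighs the term h^2 |v|^2, so the point is
        strictly inside the ball.\<close>
      have "(norm (z - (p + h *\<^sub>R v)))\<^sup>2 = (norm (z - p))\<^sup>2 - h * (2 * (v \<bullet> (z - p)) - h * (v \<bullet> v))"
        by (simp add: power2_norm_eq_inner algebra_simps inner_commute)
      also have "\<dots> < (norm (z - p))\<^sup>2" using elim by simp
      finally have "p + h *\<^sub>R v \<in> ball z (dist z p)"
        by (simp add: dist_norm power2_less_imp_less)
      then show ?case using ball neg d1(2)[of h] elim by force
    qed
    then show False by simp
  qed
qed (use assms in auto)

text \<open>A connected set that misses the frontier lies on one side of it, and the centre of the
  ball is in \<open>D\<close>.\<close>

lemma ball_closest_frontier_subset:
  fixes z :: "'a::real_normed_vector"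
  assumes "z \<in> D" and "\<And>q. q \<in> frontier D \<Longrightarrow> r \<le> dist z q"
  shows "ball z r \<subseteq> D"
proof (cases "r > 0")
  case True
  have "ball z r \<inter> frontier D = {}" using assms(2) by force
  then have "ball z r \<subseteq> D \<or> ball z r \<inter> D = {}"
    using connected_Int_frontier[of "ball z r" D] connected_ball[of z r] by blast
  moreover have "z \<in> ball z r \<inter> D" using assms(1) True by simp
  ultimately show ?thesis by blast
qed (simp add: ball_empty)

text \<open>Varying one new coordinate moves the point along a complex line in the direction of a
  column of \<open>M\<close>, and complex linearity of \<open>f'\<close> turns the chain rule into a
  complex derivative. The origin \<open>p\<close> of the coordinates drops out.\<close>

lemma complex_partial_frame:
  assumes M: "unitary_matrix M" and f: "(f has_derivative f') (at z)"
    and lin: "\<And>c v. f' (c *s v) = c * f' v"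
  shows "complex_partial (f \<circ> from_coords p M) \<mu> (to_coords p M z) = f' (M *v axis \<mu> 1)"
proof -
  define w where "w = to_coords p M z"
  have eq: "from_coords p M (\<chi> i. if i = \<mu> then t else w $ i) =
      z + (t - w $ \<mu>) *s (M *v axis \<mu> 1)" for t
  proof -
    have "(\<chi> i. if i = \<mu> then t else w $ i) = w + (t - w $ \<mu>) *s axis \<mu> 1"
      by (simp add: vec_eq_iff axis_def)
    then show ?thesis
      using from_coords_to_coords[OF M, of p z]
      by (simp add: from_coords_def w_def matrix_vector_right_distrib
          vector_scalar_commute del: vector_ssub_ldistrib vector_sub_rdistrib)
  qed
  have "((\<lambda>t. z + (t - w $ \<mu>) *s (M *v axis \<mu> 1)) has_derivative (\<lambda>t. t *s (M *v axis \<mu> 1)))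
      (at (w $ \<mu>))"
    by (auto intro!: derivative_eq_intros
        has_derivative_compose[OF _ bounded_linear_imp_has_derivative[OF bounded_linear_vector_scalar]])
  then have "((\<lambda>t. f (z + (t - w $ \<mu>) *s (M *v axis \<mu> 1))) has_derivative
      (\<lambda>t. f' (t *s (M *v axis \<mu> 1)))) (at (w $ \<mu>))"
    by (rule has_derivative_compose) (use f in simp)
  then have "((\<lambda>t. f (z + (t - w $ \<mu>) *s (M *v axis \<mu> 1))) has_field_derivative
      f' (M *v axis \<mu> 1)) (at (w $ \<mu>))"
    by (simp add: has_field_derivative_def lin mult.commute[of _ "f' _"])
  then show ?thesis
    by (auto simp: complex_partial_def eq w_def[symmetric] intro: DERIV_imp_deriv)
qed

section \<open>Admissible points over a graph\<close>

text \<open>Here \<open>q\<close> is half the Hessian form at 0. Differentiability of the gradient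
  at 0 gives G x = A x + o(|x|), and the mean value inequality along rays from 0 turns this into an
  expansion of \<phi> with error o(|x|^2).\<close>

lemma C2_quadratic_approximation:
  fixes \<phi> :: "'a::euclidean_space \<Rightarrow> real"
  assumes C2: "C2_on \<phi> S" and "open S" "0 \<in> S" and grad0: "GDERIV \<phi> 0 :> 0" and "\<phi> 0 = 0"
  obtains G C \<delta> and q :: "'a \<Rightarrow> real" where "C > 0" "\<delta> > 0"
    "\<And>x. norm x < \<delta> \<Longrightarrow> GDERIV \<phi> x :> G x \<and> norm (G x) \<le> C * norm x"
    "\<And>t x. q (t *\<^sub>R x) = t\<^sup>2 * q x"
    "\<And>\<epsilon>. \<epsilon> > 0 \<Longrightarrow> \<exists>\<delta>>0. \<forall>x. norm x < \<delta> \<longrightarrow> \<bar>\<phi> x - q x\<bar> \<le> \<epsilon> * (norm x)\<^sup>2"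
proof -
  obtain G H where GH: "\<And>x. x \<in> S \<Longrightarrow> GDERIV \<phi> x :> G x"
    "\<And>x. x \<in> S \<Longrightarrow> (G has_derivative blinfun_apply (H x)) (at x)"
    using C2 unfolding C2_on_def by auto
  have G0: "G 0 = 0"
  proof -
    have "(\<lambda>h. h \<bullet> G 0) = (\<lambda>h. h \<bullet> 0)"
      using GH(1)[OF \<open>0 \<in> S\<close>] grad0 unfolding gderiv_def by (rule has_derivative_unique)
    then show ?thesis by (metis inner_eq_zero_iff inner_zero_right)
  qed
  obtain r where r: "r > 0" "ball 0 r \<subseteq> S"
    using \<open>open S\<close> \<open>0 \<in> S\<close> openE by blast
  define A where "A = blinfun_apply (H 0)"
  interpret A: bounded_linear A unfolding A_def by (rule blinfun.bounded_linear_right)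
  have approx: "\<exists>\<delta>>0. \<delta> \<le> r \<and> (\<forall>x. norm x < \<delta> \<longrightarrow> norm (G x - A x) \<le> \<epsilon> * norm x)"
    if "\<epsilon> > 0" for \<epsilon>
  proof -
    from GH(2)[OF \<open>0 \<in> S\<close>] obtain d where "d > 0"
      "\<And>y. norm (y - 0) < d \<Longrightarrow> norm (G y - G 0 - blinfun_apply (H 0) (y - 0)) \<le> \<epsilon> * norm (y - 0)"
      unfolding has_derivative_at_alt using \<open>\<epsilon> > 0\<close> by meson
    then show ?thesis using r(1) G0 by (intro exI[of _ "min d r"]) (auto simp: A_def)
  qed
  obtain \<delta> where \<delta>: "\<delta> > 0" "\<delta> \<le> r" "\<And>x. norm x < \<delta> \<Longrightarrow> norm (G x - A x) \<le> 1 * norm x"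
    using approx[of 1] by auto
  obtain K where K: "K \<ge> 0" "\<And>x. norm (A x) \<le> norm x * K"
    using A.nonneg_bounded by auto
  \<comment> \<open>With the factor 1/2, \<open>t\<^sup>2 * q x\<close> has the t-derivative
    \<open>x \<bullet> A (t *\<^sub>R x)\<close>, so that the derivative of the difference along the
    ray involves only G - A.\<close>
  define q where "q x = (x \<bullet> A x) / 2" for x
  \<comment> \<open>The gradient bound adds the bound \<open>K\<close> of the Hessian to the
    linearisation error taken with \<epsilon> = 1.\<close>
  show thesis
  proof (rule that[of "K + 1" \<delta> G q])
    show "GDERIV \<phi> x :> G x \<and> norm (G x) \<le> (K + 1) * norm x" if "norm x < \<delta>" for x
    proof
      show "GDERIV \<phi> x :> G x" using GH(1) r(2) \<delta>(2) that by (auto simp: subset_iff)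
      have "norm (G x) \<le> norm (G x - A x) + norm (A x)" by (metis diff_add_cancel norm_triangle_ineq)
      then show "norm (G x) \<le> (K + 1) * norm x"
        using \<delta>(3)[OF that] K(2)[of x] by (simp add: algebra_simps)
    qed
    show "q (t *\<^sub>R x) = t\<^sup>2 * q x" for t x
      by (simp add: q_def A.scaleR power2_eq_square)
    fix \<epsilon> :: real assume "\<epsilon> > 0"
    then obtain d where d: "d > 0" "d \<le> r" "\<And>x. norm x < d \<Longrightarrow> norm (G x - A x) \<le> \<epsilon> * norm x"
      using approx by blast
    show "\<exists>\<delta>>0. \<forall>x. norm x < \<delta> \<longrightarrow> \<bar>\<phi> x - q x\<bar> \<le> \<epsilon> * (norm x)\<^sup>2"
    proof (intro exI[of _ d] conjI allI impI d(1))
      fix x :: 'a assume x: "norm x < d"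
      have tx: "norm (t *\<^sub>R x) \<le> norm x" if "t \<in> {0..1}" for t
        using that by (simp add: mult_left_le_one_le)
      define k where "k t = \<phi> (t *\<^sub>R x) - t\<^sup>2 * q x" for t
      have "norm (k 1 - k 0) \<le> (\<epsilon> * (norm x)\<^sup>2) * norm (1 - 0 :: real)"
      proof (rule differentiable_bound[where S = "{0..1}"])
        fix t :: real assume t: "t \<in> {0..1}"
        have "t *\<^sub>R x \<in> S" using tx[OF t] x d(2) r(2) by (auto simp: subset_iff)
        then have "((\<lambda>t. \<phi> (t *\<^sub>R x)) has_derivative (\<lambda>s. (s *\<^sub>R x) \<bullet> G (t *\<^sub>R x)))
            (at t within {0..1})"
          using GH(1)[of "t *\<^sub>R x"] unfolding gderiv_def
          by (intro has_derivative_compose[where f = "\<lambda>t. t *\<^sub>R x" and g = \<phi>])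
            (auto intro!: derivative_eq_intros)
        then show "(k has_derivative (\<lambda>s. s * (x \<bullet> (G (t *\<^sub>R x) - A (t *\<^sub>R x))))) (at t within {0..1})"
          unfolding k_def[abs_def]
          by (auto intro!: derivative_eq_intros
              simp: q_def A.scaleR inner_diff_right algebra_simps)
        have "\<bar>x \<bullet> (G (t *\<^sub>R x) - A (t *\<^sub>R x))\<bar> \<le> norm x * norm (G (t *\<^sub>R x) - A (t *\<^sub>R x))"
          by (rule Cauchy_Schwarz_ineq2)
        also have "\<dots> \<le> norm x * (\<epsilon> * norm (t *\<^sub>R x))"
          using tx[OF t] x by (intro mult_left_mono d(3)) auto
        also have "\<dots> \<le> norm x * (\<epsilon> * norm x)"
          using tx[OF t] \<open>\<epsilon> > 0\<close> by (intro mult_left_mono) auto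
        finally have "\<bar>x \<bullet> (G (t *\<^sub>R x) - A (t *\<^sub>R x))\<bar> \<le> \<epsilon> * (norm x)\<^sup>2"
          by (simp add: power2_eq_square mult_ac)
        then show "onorm (\<lambda>s. s * (x \<bullet> (G (t *\<^sub>R x) - A (t *\<^sub>R x)))) \<le> \<epsilon> * (norm x)\<^sup>2"
          by (intro onorm_le) (simp add: abs_mult mult_left_mono mult.commute)
      qed auto
      then show "\<bar>\<phi> x - q x\<bar> \<le> \<epsilon> * (norm x)\<^sup>2"
        using \<open>\<phi> 0 = 0\<close> by (simp add: k_def)
    qed
  qed (use K \<delta> in auto)
qed

text \<open>Here \<phi> is the graph function viewed on the whole space; \<open>\<phi>_zeta\<close>
  expresses that it does not depend on the real part of the first coordinate. The function
  \<open>q\<close> is its quadratic part at 0.\<close>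

locale quadratic_graph =
  fixes i0 :: "'n::finite" and \<phi> :: "complex ^ 'n \<Rightarrow> real" and G :: "complex ^ 'n \<Rightarrow> complex ^ 'n"
    and C r :: real and q :: "complex ^ 'n \<Rightarrow> real"
  assumes C: "C > 0" and r: "r > 0"
    and \<phi>_0: "\<phi> 0 = 0"
    and \<phi>_zeta: "\<phi> (zeta_part i0 w) = \<phi> w"
    and grad: "norm w < r \<Longrightarrow> GDERIV \<phi> w :> G w"
    and grad_bound: "norm w < r \<Longrightarrow> norm (G w) \<le> C * norm w"
    and q_scale: "q (t *\<^sub>R w) = t\<^sup>2 * q w"
    and q_approx: "\<epsilon> > 0 \<Longrightarrow> \<exists>\<delta>>0. \<forall>w. norm w < \<delta> \<longrightarrow> \<bar>\<phi> w - q w\<bar> \<le> \<epsilon> * (norm w)\<^sup>2"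
begin

section \<open>Depth, admissibility and their stability under small displacements\<close>

definition depth :: "complex ^ 'n \<Rightarrow> real" where
  "depth w = min (Re (w $ i0)) (Re (w $ i0) - \<phi> w)"

definition admissible :: "real \<Rightarrow> complex ^ 'n \<Rightarrow> bool" where
  "admissible \<alpha> w \<longleftrightarrow> (norm w)\<^sup>2 < \<alpha> * depth w \<and> \<bar>Im (w $ i0)\<bar> < \<alpha> * Re (w $ i0)"

definition shrink :: "real \<Rightarrow> complex ^ 'n \<Rightarrow> complex ^ 'n" where
  "shrink t w = Re (w $ i0) *\<^sub>R axis i0 1 + t *\<^sub>R zeta_part i0 w"

text \<open>The Lipschitz constant is proportional to the radius: for points of size O(sqrt d) at
  distance c sqrt d, the values differ by O(c d), a small fraction of a depth d.\<close>

lemma \<phi>_lipschitz: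
  assumes "norm v \<le> \<rho>" "norm w \<le> \<rho>" "\<rho> < r"
  shows "\<bar>\<phi> v - \<phi> w\<bar> \<le> C * \<rho> * norm (v - w)"
proof -
  have "norm (\<phi> v - \<phi> w) \<le> C * \<rho> * norm (v - w)"
  proof (rule differentiable_bound[where S = "cball 0 \<rho>"])
    fix x :: "complex ^ 'n" assume x: "x \<in> cball 0 \<rho>"
    show "(\<phi> has_derivative (\<lambda>h. h \<bullet> G x)) (at x within cball 0 \<rho>)"
      using grad[of x] x assms(3) by (auto simp: gderiv_def intro: has_derivative_at_withinI)
    have "norm (G x) \<le> C * \<rho>"
      using grad_bound[of x] x assms(3) mult_left_mono[of "norm x" \<rho> C] C
      by (auto intro: order_trans)
    then show "onorm (\<lambda>h. h \<bullet> G x) \<le> C * \<rho>"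
      by (intro onorm_le)
        (simp, smt (verit) Cauchy_Schwarz_ineq2 mult.commute mult_right_mono norm_ge_zero)
  qed (use assms in auto)
  then show ?thesis by simp
qed

lemma \<phi>_bound: "norm w < r \<Longrightarrow> \<bar>\<phi> w\<bar> \<le> C * (norm w)\<^sup>2"
  using \<phi>_lipschitz[of 0 "norm w" w] \<phi>_0 by (simp add: power2_eq_square)

lemma depth_le: "depth w \<le> Re (w $ i0)" "depth w \<le> norm w"
  using complex_Re_le_cmod[of "w $ i0"] Finite_Cartesian_Product.norm_nth_le[of w i0]
  by (auto simp: depth_def)

lemma admissible_depth_pos:
  assumes "admissible \<alpha> w" "\<alpha> > 0" shows "depth w > 0"
  using assms zero_le_power2[of "norm w"]
  by (metis admissible_def order_le_less_trans zero_less_mult_pos)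

lemma admissible_norm_le:
  assumes "admissible \<alpha> w" "\<alpha> > 0"
  shows "norm w \<le> sqrt \<alpha> * sqrt (depth w)"
  using assms by (simp add: admissible_def real_sqrt_mult[symmetric] real_le_rsqrt)

text \<open>Since \<phi> w \<le> C |w|^2 \<le> C \<alpha> \<open>depth w\<close>, the two terms of
  the minimum defining the depth are comparable at admissible points.\<close>

lemma admissible_Re_le_depth:
  assumes "admissible \<alpha> w" "\<alpha> > 0" "norm w < r"
  shows "Re (w $ i0) \<le> (1 + C * \<alpha>) * depth w"
proof -
  have "\<phi> w \<le> C * (norm w)\<^sup>2" using \<phi>_bound[OF assms(3)] by simp
  also have "\<dots> \<le> C * (\<alpha> * depth w)" using assms(1) C by (auto simp: admissible_def)
  finally have "\<phi> w \<le> C * \<alpha> * depth w" by simp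
  moreover have "0 \<le> C * \<alpha> * depth w" using admissible_depth_pos[OF assms(1,2)] C assms(2) by simp
  ultimately show ?thesis by (auto simp: depth_def algebra_simps min_def split: if_splits)
qed

text \<open>A displacement of order sqrt d, but only of order d in the first coordinate, changes the
  real part and \<phi> by at most d / 4 each, so at least half of the depth d survives. The bound on
  \<open>norm v\<close> makes the perturbed points tend to 0 together with \<open>w\<close>.\<close>

lemma admissible_perturb:
  assumes \<alpha>: "\<alpha> > 0"
  obtains c \<beta> \<delta> where "c > 0" "\<beta> > 0" "\<delta> > 0"
    "\<And>w v. \<lbrakk>norm w < \<delta>; admissible \<alpha> w; norm (v - w) \<le> c * sqrt (depth w);
        norm (v $ i0 - w $ i0) \<le> c * depth w\<rbrakk> \<Longrightarrow> admissible \<beta> v \<and> norm v \<le> 2 * sqrt (norm w)"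
proof -
  \<comment> \<open>Both points will have norm at most \<open>s * sqrt d\<close>; then
    \<open>c\<close> makes the variation of \<phi>, at most \<open>C * s * c * d\<close>, no larger
    than \<open>d / 4\<close>.\<close>
  define s where "s = sqrt \<alpha> + 1"
  have s: "s \<ge> 1" "s\<^sup>2 \<ge> \<alpha> + 1" using \<alpha> by (auto simp: s_def power2_sum)
  define c where "c = min (1 / 4) (1 / (4 * C * s))"
  have c: "c > 0" "c \<le> 1 / 4" "C * s * c \<le> 1 / 4"
  proof -
    show "c > 0" "c \<le> 1 / 4" using C s by (auto simp: c_def)
    have "c \<le> 1 / (4 * C * s)" by (simp add: c_def)
    then show "C * s * c \<le> 1 / 4" using C s by (simp add: field_simps)
  qed
  \<comment> \<open>The term \<open>2 * s\<^sup>2\<close> comes from |v|^2 \<le> s^2 d and depth at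
    least d / 2 at \<open>v\<close>; the 1 makes the inequality strict. Because s^2 \<ge> \<alpha> +
    1, the same \<beta> covers the condition on the imaginary part.\<close>
  define \<beta> where "\<beta> = 2 * s\<^sup>2 + 1"
  \<comment> \<open>The bound 1 gives |w| \<le> sqrt |w|, and (r / 2)^2 gives 2 sqrt |w| < r, so
    that both points lie where \<phi> is controlled.\<close>
  define \<delta> where "\<delta> = min 1 ((r / 2)\<^sup>2)"
  show thesis
  proof (rule that[of c \<beta> \<delta>])
    show "c > 0" "\<beta> > 0" "\<delta> > 0" using c r by (auto simp: \<beta>_def \<delta>_def add_nonneg_pos)
    fix w v
    assume w: "norm w < \<delta>" and adm: "admissible \<alpha> w"
      and near: "norm (v - w) \<le> c * sqrt (depth w)" and near1: "norm (v $ i0 - w $ i0) \<le> c * depth w"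
    define d where "d = depth w"
    have d: "d > 0" using admissible_depth_pos[OF adm \<alpha>] by (simp add: d_def)
    have w1: "norm w < 1" using w by (simp add: \<delta>_def)
    have sw: "norm w \<le> sqrt (norm w)"
      using w1 by (intro real_le_rsqrt) (simp add: power2_eq_square mult_left_le_one_le)
    have "sqrt (norm w) < r / 2" using w r by (intro real_less_lsqrt) (auto simp: \<delta>_def)
    have "sqrt d \<le> sqrt (norm w)" using depth_le(2)[of w] by (simp add: d_def)
    moreover have "c * sqrt d \<le> sqrt d" using c d by (simp add: mult_left_le_one_le)
    ultimately have vw: "norm v \<le> 2 * sqrt (norm w)"
      using near sw norm_triangle_ineq[of "v - w" w] unfolding d_def diff_add_cancel by linarith
    then have vr: "norm v < r" "norm w < r" using \<open>sqrt (norm w) < r / 2\<close> sw r by linarith+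
    have sd: "sqrt d \<ge> 0" "c * sqrt d \<le> 1 * sqrt d" using c d by (auto intro!: mult_right_mono)
    have ws: "norm w \<le> s * sqrt d"
      using admissible_norm_le[OF adm \<alpha>] sd unfolding s_def d_def distrib_right by linarith
    have vs: "norm v \<le> s * sqrt d"
      using near admissible_norm_le[OF adm \<alpha>] norm_triangle_ineq[of "v - w" w] sd
      unfolding s_def d_def distrib_right diff_add_cancel by linarith
    define \<rho> where "\<rho> = max (norm v) (norm w)"
    have "\<bar>\<phi> v - \<phi> w\<bar> \<le> C * \<rho> * norm (v - w)"
      using vr by (intro \<phi>_lipschitz) (auto simp: \<rho>_def)
    also have "\<dots> \<le> C * (s * sqrt d) * (c * sqrt d)"
      using ws vs near C c d s by (intro mult_mono) (auto simp: \<rho>_def d_def le_max_iff_disj)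
    also have "\<dots> = C * s * c * d" using d by simp
    also have "\<dots> \<le> d / 4" using c(3) d mult_right_mono[of "C * s * c" "1 / 4" d] by simp
    finally have \<phi>: "\<bar>\<phi> v - \<phi> w\<bar> \<le> d / 4" .
    have "norm (v $ i0 - w $ i0) \<le> d / 4"
      using near1 mult_right_mono[OF c(2) less_imp_le[OF d]] unfolding d_def by linarith
    then have x: "\<bar>Re (v $ i0) - Re (w $ i0)\<bar> \<le> d / 4" and y: "\<bar>Im (v $ i0) - Im (w $ i0)\<bar> \<le> d / 4"
      using abs_Re_le_cmod[of "v $ i0 - w $ i0"] abs_Im_le_cmod[of "v $ i0 - w $ i0"] by auto
    have dv: "depth v \<ge> d / 2" 
    proof -
      have "d \<le> Re (w $ i0)" "d \<le> Re (w $ i0) - \<phi> w" by (auto simp: d_def depth_def)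
      then show ?thesis unfolding depth_def[of v] using x \<phi> by (intro min.boundedI) linarith+
    qed
    have "(norm v)\<^sup>2 \<le> (s * sqrt d)\<^sup>2" using vs by (intro power_mono) auto
    also have "\<dots> = 2 * s\<^sup>2 * (d / 2)" using d by (simp add: power_mult_distrib)
    also have "\<dots> \<le> 2 * s\<^sup>2 * depth v" using dv by (intro mult_left_mono) auto
    also have "\<dots> < \<beta> * depth v" using dv d by (intro mult_strict_right_mono) (auto simp: \<beta>_def)
    finally have 1: "(norm v)\<^sup>2 < \<beta> * depth v" .
    have xw: "Re (w $ i0) \<ge> d" using depth_le(1)[of w] by (simp add: d_def)
    have "\<bar>Im (v $ i0)\<bar> < \<alpha> * Re (w $ i0) + d / 4" using y adm unfolding admissible_def by linarith
    also have "\<dots> \<le> (\<alpha> + 1 / 4) * Re (w $ i0)" using xw by (simp add: algebra_simps)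
    \<comment> \<open>The real part at \<open>w\<close> is at least d and changes by at most d / 4,
      so it is at most 4/3 of the real part at \<open>v\<close>.\<close>
    also have "\<dots> \<le> (\<alpha> + 1 / 4) * (4 / 3 * Re (v $ i0))"
      using x xw \<alpha> d by (intro mult_left_mono) linarith+
    also have "\<dots> \<le> \<beta> * Re (v $ i0)"
    proof -
      have "(\<alpha> + 1 / 4) * (4 / 3) \<le> \<beta>" using s \<alpha> by (simp add: \<beta>_def)
      moreover have "Re (v $ i0) \<ge> 0" using x xw d by linarith
      ultimately show ?thesis
        using mult_right_mono[of "(\<alpha> + 1 / 4) * (4 / 3)" \<beta> "Re (v $ i0)"]
        by (simp add: algebra_simps)
    qed
    finally show "admissible \<beta> v \<and> norm v \<le> 2 * sqrt (norm w)"
      using 1 vw by (simp add: admissible_def)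
  qed
qed

section \<open>Contraction towards the normal axis\<close>

lemma zeta_part_shrink: "zeta_part i0 (shrink t w) = t *\<^sub>R zeta_part i0 w"
  by (simp add: zeta_part_def shrink_def vec_eq_iff axis_def complex_eq_iff)

lemma shrink_component:
  "shrink t w $ i0 = Complex (Re (w $ i0)) (t * Im (w $ i0))"
  "i \<noteq> i0 \<Longrightarrow> shrink t w $ i = t *\<^sub>R (w $ i)"
  by (simp_all add: zeta_part_def shrink_def axis_def complex_eq_iff)

lemma shrink_1: "shrink 1 w = w"
  by (simp add: zeta_part_def shrink_def vec_eq_iff axis_def complex_eq_iff)

lemma norm_zeta_part_le: "norm (zeta_part i0 w) \<le> norm w"
  by (rule norm_le_componentwise_cart) (auto simp: zeta_part_def cmod_def)

lemma norm_shrink_le: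
  assumes "0 \<le> t" "t \<le> 1" shows "norm (shrink t w) \<le> norm w"
proof (rule norm_le_componentwise_cart)
  fix i
  have "t\<^sup>2 \<le> 1" using assms by (simp add: power_le_one)
  then have "norm (shrink t w $ i0) \<le> norm (w $ i0)"
    unfolding shrink_component cmod_def
    by (simp add: power_mult_distrib mult_left_le_one_le)
  then show "norm (shrink t w $ i) \<le> norm (w $ i)"
    using assms by (cases "i = i0") (auto simp: shrink_component mult_left_le_one_le)
qed

text \<open>The quadratic part of \<open>\<phi>\<close> scales with \<open>t\<^sup>2\<close>, so that up to an error \<open>o(depth w)\<close> the height of
  the shrunk point over the graph is at least a convex combination of \<open>Re (w $ i0)\<close> and
  \<open>Re (w $ i0) - \<phi> w\<close>. Both are bounded below by \<open>depth w\<close>.\<close>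

lemma admissible_shrink:
  assumes \<alpha>: "\<alpha> > 0"
  obtains \<delta> where "\<delta> > 0"
    "\<And>w t. \<lbrakk>norm w < \<delta>; admissible \<alpha> w; 0 \<le> t; t \<le> 1\<rbrakk> \<Longrightarrow> admissible (2 * \<alpha>) (shrink t w)"
proof -
  \<comment> \<open>As |w|^2 < \<alpha> \<open>depth w\<close>, the accuracy 1 / (4 \<alpha>) keeps
    the error below a quarter of the depth.\<close>
  obtain \<delta> where \<delta>: "\<delta> > 0" "\<And>w. norm w < \<delta> \<Longrightarrow> \<bar>\<phi> w - q w\<bar> \<le> 1 / (4 * \<alpha>) * (norm w)\<^sup>2"
    using q_approx[of "1 / (4 * \<alpha>)"] \<alpha> by auto
  show thesis
  proof (rule that[OF \<delta>(1)])
    fix w t assume w: "norm w < \<delta>" and adm: "admissible \<alpha> w" and t: "0 \<le> t" "t \<le> (1::real)"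
    define z where "z = zeta_part i0 w"
    define d where "d = depth w"
    have d: "d > 0" using admissible_depth_pos[OF adm \<alpha>] by (simp add: d_def)
    have t2: "0 \<le> t\<^sup>2" "t\<^sup>2 \<le> 1" using t by (auto simp: power_le_one)
    have err: "\<bar>\<phi> u - q u\<bar> \<le> d / 4" if "norm u \<le> norm w" for u
    proof -
      have "\<bar>\<phi> u - q u\<bar> \<le> 1 / (4 * \<alpha>) * (norm u)\<^sup>2" using \<delta>(2) that w by simp
      also have "\<dots> \<le> 1 / (4 * \<alpha>) * (\<alpha> * d)"
      proof (rule mult_left_mono)
        show "(norm u)\<^sup>2 \<le> \<alpha> * d"
          using adm power_mono[OF that norm_ge_zero, of 2] unfolding admissible_def d_def by linarith
      qed (use \<alpha> in simp)
      finally show ?thesis using \<alpha> by simp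
    qed
    have nz: "norm z \<le> norm w" by (simp add: z_def norm_zeta_part_le)
    moreover have "norm (t *\<^sub>R z) \<le> norm z" using t by (simp add: mult_left_le_one_le)
    ultimately have e: "\<bar>\<phi> z - q z\<bar> \<le> d / 4" "\<bar>\<phi> (t *\<^sub>R z) - t\<^sup>2 * q z\<bar> \<le> d / 4"
      using err[of z] err[of "t *\<^sub>R z"] by (auto simp: q_scale)
    have \<phi>s: "\<phi> (shrink t w) = \<phi> (t *\<^sub>R z)"
      using \<phi>_zeta[of "shrink t w"] by (simp add: zeta_part_shrink z_def)
    have \<phi>z: "\<phi> z = \<phi> w" by (simp add: z_def \<phi>_zeta)
    \<comment> \<open>One quarter of \<open>d\<close> is lost in passing from \<phi> to
      \<open>q\<close> at \<open>z\<close>, another in returning to \<phi> at the shrunk point. Half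
      of the depth is left, whence the aperture 2\<alpha>.\<close>
    have "t\<^sup>2 * q z \<le> t\<^sup>2 * (\<phi> w + d / 4)" using e(1) t2 \<phi>z by (intro mult_left_mono) linarith+
    also have "\<dots> \<le> t\<^sup>2 * \<phi> w + d / 4" using t2 d by (simp add: algebra_simps)
    finally have "\<phi> (shrink t w) \<le> t\<^sup>2 * \<phi> w + d / 2" using e(2) \<phi>s by linarith
    moreover have "(1 - t\<^sup>2) * d + t\<^sup>2 * d \<le> (1 - t\<^sup>2) * Re (w $ i0) + t\<^sup>2 * (Re (w $ i0) - \<phi> w)"
      using t2 by (intro add_mono mult_left_mono) (auto simp: d_def depth_def)
    ultimately have ds: "depth (shrink t w) \<ge> d / 2"
      using d depth_le(1)[of w] by (simp add: depth_def[of "shrink t w"] shrink_component d_def algebra_simps)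
    have "(norm (shrink t w))\<^sup>2 \<le> (norm w)\<^sup>2" using norm_shrink_le[OF t] by (intro power_mono) auto
    also have "\<dots> < \<alpha> * d" using adm by (simp add: admissible_def d_def)
    also have "\<dots> \<le> 2 * \<alpha> * depth (shrink t w)" using ds \<alpha> by simp
    finally have "(norm (shrink t w))\<^sup>2 < 2 * \<alpha> * depth (shrink t w)" .
    moreover have "\<bar>t * Im (w $ i0)\<bar> < 2 * \<alpha> * Re (w $ i0)"
    proof -
      have "\<bar>t * Im (w $ i0)\<bar> \<le> \<bar>Im (w $ i0)\<bar>" using t by (simp add: abs_mult mult_left_le_one_le)
      also have "\<dots> < \<alpha> * Re (w $ i0)" using adm by (simp add: admissible_def)
      also have "\<dots> \<le> 2 * \<alpha> * Re (w $ i0)" using depth_le(1)[of w] d \<alpha> by (simp add: d_def)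
      finally show ?thesis .
    qed
    ultimately show "admissible (2 * \<alpha>) (shrink t w)" by (simp add: admissible_def shrink_component)
  qed
qed

end

section \<open>Spherical derivatives in moving frames\<close>

text \<open>Since |G w| \<le> C |w|, the condition \<open>C * r < 1\<close> keeps the gradient of
  the graph function shorter than a unit vector, so that \<open>G w - axis i0 1\<close> does not
  vanish for |w| < r.\<close>

locale admissible_setting =
  quadratic_graph i0 "\<lambda>w. \<psi> (zeta_part i0 w)" G C r q
  for i0 :: "'n::finite" and \<psi> :: "complex ^ 'n \<Rightarrow> real" and G C r q +
  fixes D V :: "(complex ^ 'n) set" and \<xi> :: "complex ^ 'n" and W :: "complex ^ 'n ^ 'n"
    and F :: "complex ^ 'n \<Rightarrow> complex ^ 'n ^ 'n" and f :: "complex ^ 'n \<Rightarrow> complex"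
  assumes W: "unitary_matrix W"
    and Cr: "C * r < 1"
    and \<xi>: "\<xi> \<in> frontier D"
    and V: "ball \<xi> r \<subseteq> V"
    and D_iff: "dist z \<xi> < r \<Longrightarrow>
      z \<in> D \<longleftrightarrow> Re (to_coords \<xi> W z $ i0) > \<psi> (zeta_part i0 (to_coords \<xi> W z))"
    and frontier_iff: "dist z \<xi> < r \<Longrightarrow>
      z \<in> frontier D \<longleftrightarrow> Re (to_coords \<xi> W z $ i0) = \<psi> (zeta_part i0 (to_coords \<xi> W z))"
    and D_open: "open D"
    and frames: "moving_frame i0 D V F"
    and f_holo: "holomorphic_Cn_on f D"
begin

abbreviation coords :: "complex ^ 'n \<Rightarrow> complex ^ 'n" where
  "coords \<equiv> to_coords \<xi> W"

abbreviation region :: "real \<Rightarrow> (complex ^ 'n) set" where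
  "region \<equiv> admissible_domain i0 D \<xi> W \<psi> V"

abbreviation sderiv :: "'n \<Rightarrow> complex ^ 'n \<Rightarrow> real" where
  "sderiv \<equiv> spherical_derivative D F f"

text \<open>The frame at \<open>z\<close> expressed in the coordinates at \<xi>; near \<xi> its
  first column is close to \<open>axis i0 1\<close> up to sign.\<close>

definition frame :: "complex ^ 'n \<Rightarrow> complex ^ 'n ^ 'n" where
  "frame z = adjoint_matrix W ** F z"

section \<open>Admissible domains and frames in the coordinates at \<xi>\<close>

lemma boundary_d_eq: "boundary_d i0 \<xi> W \<psi> z = depth (coords z)"
  by (simp add: boundary_d_def depth_def Let_def)

lemma region_iff: "z \<in> region \<alpha> \<longleftrightarrow> z \<in> D \<inter> V \<and> admissible \<alpha> (coords z)"
  by (simp add: admissible_domain_def admissible_def boundary_d_eq Let_def)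

lemma norm_coords: "norm (coords z) = dist z \<xi>"
  by (rule norm_to_coords[OF W])

text \<open>Positive depth puts a point above the graph, so near \<xi> membership in
  \<open>D\<close> and \<open>V\<close> is automatic.\<close>

lemma region_near_iff:
  assumes "dist z \<xi> < r" "\<alpha> > 0"
  shows "z \<in> region \<alpha> \<longleftrightarrow> admissible \<alpha> (coords z)"
proof -
  have "z \<in> D \<inter> V" if "admissible \<alpha> (coords z)"
    using admissible_depth_pos[OF that assms(2)] D_iff[OF assms(1)] V assms(1)
    by (auto simp: depth_def dist_commute subset_iff)
  then show ?thesis by (auto simp: region_iff)
qed

text \<open>The ball about \<open>z\<close> through its closest boundary point p lies in
  \<open>D\<close>, so \<open>interior_ball_normal\<close> gives the normal \<open>n\<close> and the
  gradient of the graph's defining function the same direction at p. In the coordinates at \<xi>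
  that gradient is G - \<open>axis i0 1\<close> with |G| \<le> C |p - \<xi>| \<le> 2 C |z - \<xi>|,
  and normalising doubles the error. The minus sign makes the normal point inward.\<close>

lemma normal_near:
  assumes z: "z \<in> D" "2 * dist z \<xi> < r"
    and n: "outward_unit_normal D (closest_point (frontier D) z) n"
  shows "norm (- (adjoint_matrix W *v n) - axis i0 1) \<le> 4 * C * dist z \<xi>"
proof -
  define p where "p = closest_point (frontier D) z"
  have p: "p \<in> frontier D" "\<And>y. y \<in> frontier D \<Longrightarrow> dist z p \<le> dist z y"
    using closest_point_in_set[of "frontier D" z] closest_point_le[of "frontier D"] \<xi>
    by (auto simp: p_def)
  have zp: "z \<noteq> p" using p(1) z(1) D_open by (auto simp: frontier_def interior_open)
  \<comment> \<open>The point \<xi> itself competes for being closest to \<open>z\<close>.\<close>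
  have p\<xi>: "dist p \<xi> \<le> 2 * dist z \<xi>"
    using p(2)[OF \<xi>] dist_triangle[of p \<xi> z] by (simp add: dist_commute)
  then have pr: "dist p \<xi> < r" using z(2) by linarith
  have ball: "ball z (dist z p) \<subseteq> D" by (rule ball_closest_frontier_subset[OF z(1) p(2)])
  define a where "a = G (coords p) - axis i0 1"
  have "norm (G (coords p)) \<le> C * dist p \<xi>"
    using grad_bound[of "coords p"] pr by (simp add: norm_coords)
  then have Gp: "norm (G (coords p)) \<le> 2 * C * dist z \<xi>"
    using mult_left_mono[OF p\<xi> less_imp_le[OF C]] by linarith
  have e1: "norm (axis i0 1 :: complex ^ 'n) = 1" by (simp add: norm_eq_sqrt_inner inner_axis_axis)
  have "2 * C * dist z \<xi> < 1"
    using mult_strict_left_mono[OF z(2) C] Cr by (simp add: mult_ac)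
  then have a0: "a \<noteq> 0" using Gp e1 by (auto simp: a_def)
  define \<rho> where "\<rho> y = \<psi> (zeta_part i0 (coords y)) - Re (coords y $ i0)" for y
  have "sgn (W *v a) = - sgn (z - p)"
  proof (rule interior_ball_normal[OF ball zp])
    have "(coords has_derivative (\<lambda>h. adjoint_matrix W *v h)) (at p)"
      unfolding to_coords_def[abs_def]
      by (auto intro!: derivative_eq_intros
          has_derivative_compose[OF _ bounded_linear_imp_has_derivative[OF bounded_linear_matrix_vector]])
    moreover have "((\<lambda>w. \<psi> (zeta_part i0 w) - w \<bullet> axis i0 1) has_derivative (\<lambda>h. h \<bullet> a)) (at (coords p))"
      using grad[of "coords p"] pr unfolding gderiv_def norm_coords a_def
      by (auto intro!: derivative_eq_intros simp: inner_diff_right)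
    ultimately have "((\<lambda>y. \<psi> (zeta_part i0 (coords y)) - coords y \<bullet> axis i0 1) has_derivative
        (\<lambda>h. (adjoint_matrix W *v h) \<bullet> a)) (at p)"
      by (rule has_derivative_compose)
    moreover have "(adjoint_matrix W *v h) \<bullet> a = h \<bullet> (W *v a)" for h
      by (metis Re_hprod hprod_adjoint)
    ultimately show "GDERIV \<rho> p :> W *v a"
      by (simp add: gderiv_def \<rho>_def[abs_def] inner_axis inner_complex_def)
    show "\<rho> p = 0" using frontier_iff[OF pr] p(1) by (simp add: \<rho>_def)
    show "W *v a \<noteq> 0" using a0 unitary_norm[OF W, of a] by auto
    show "open (ball \<xi> r)" "p \<in> ball \<xi> r" using pr by (auto simp: dist_commute)
    show "\<rho> y \<le> 0" if "y \<in> ball \<xi> r" "y \<in> D" for y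
      using D_iff[of y] that by (auto simp: \<rho>_def dist_commute)
  qed
  moreover obtain N \<rho>' g where g: "local_defining_function D p N \<rho>'" "GDERIV \<rho>' p :> g" "n = g /\<^sub>R norm g"
    using n unfolding outward_unit_normal_def p_def by blast
  \<comment> \<open>The same touching ball fixes the gradient direction of the defining function
    behind \<open>n\<close>, so the two functions need no direct comparison.\<close>
  have "sgn g = - sgn (z - p)"
  proof (rule interior_ball_normal[OF ball zp g(2)])
    show "\<rho>' p = 0" "g \<noteq> 0" "open N" "p \<in> N"
      using g(1,2) p(1) unfolding local_defining_function_def by blast+
    show "\<rho>' y \<le> 0" if "y \<in> N" "y \<in> D" for y
      using g(1) that unfolding local_defining_function_def
      by (metis (mono_tags, lifting) IntI less_imp_le mem_Collect_eq)
  qed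
  ultimately have "n = sgn (W *v a)" using g(3) by (simp add: sgn_div_norm)
  also have "\<dots> = W *v sgn a"
    by (simp add: sgn_div_norm unitary_norm[OF W] matrix_vector_scaleR)
  finally have "- (adjoint_matrix W *v n) = sgn (- a)"
    by (simp add: unitary_cancel[OF W] sgn_minus)
  moreover have "norm (sgn (- a) - axis i0 1) \<le> 2 * norm (- a - axis i0 1)"
    by (rule norm_sgn_diff_le[OF e1])
  ultimately show ?thesis using Gp by (simp add: a_def)
qed

text \<open>The choice between inward and outward normal only changes a sign. The error |v| |z -
  \<xi>| is O(d) for |v| = O(sqrt d) at admissible \<open>z\<close>, which is as small as the normal
  components themselves.\<close>

lemma frame_facts:
  assumes z: "z \<in> D \<inter> V" "2 * dist z \<xi> < r"
  shows "unitary_matrix (F z)" "unitary_matrix (frame z)"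
    "W *v (frame z *v v) = F z *v v"
    "norm ((adjoint_matrix (frame z) *v v) $ i0) \<le> norm (v $ i0) + norm v * (4 * C * dist z \<xi>)"
    "norm (v $ i0) \<le> norm ((adjoint_matrix (frame z) *v v) $ i0) + norm v * (4 * C * dist z \<xi>)"
proof -
  obtain n where n: "outward_unit_normal D (closest_point (frontier D) z) n"
    and ad: "adapted_frame i0 n (F z) \<or> adapted_frame i0 (- n) (F z)"
    using frames z(1) unfolding moving_frame_def by blast
  show Fz: "unitary_matrix (F z)" using ad by (auto simp: adapted_frame_def)
  then show fr: "unitary_matrix (frame z)"
    unfolding frame_def by (intro unitary_mul unitary_adjoint W)
  show "W *v (frame z *v v) = F z *v v"
    by (simp add: frame_def matrix_vector_mul_assoc[symmetric] unitary_cancel[OF W])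
  define m where "m = - (adjoint_matrix W *v n)"
  have "adjoint_matrix W *v (- n) = m"
    by (simp add: m_def matrix_vector_mult_def vec_eq_iff sum_negf)
  then have first: "frame z *v axis i0 1 = m \<or> frame z *v axis i0 1 = - m"
    using ad by (auto simp: frame_def matrix_vector_mul_assoc[symmetric] adapted_frame_def m_def)
  have m: "norm (m - axis i0 1) \<le> 4 * C * dist z \<xi>"
    unfolding m_def using z by (intro normal_near n) auto
  note le = mult_left_mono[OF m norm_ge_zero[of v]]
  show "norm ((adjoint_matrix (frame z) *v v) $ i0) \<le> norm (v $ i0) + norm v * (4 * C * dist z \<xi>)"
    "norm (v $ i0) \<le> norm ((adjoint_matrix (frame z) *v v) $ i0) + norm v * (4 * C * dist z \<xi>)"
    using frame_first_component[OF fr first, of v] le by linarith+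
qed

section \<open>Spherical derivatives as derivatives along frame vectors\<close>

lemma sderiv_eq:
  assumes z: "z \<in> D \<inter> V" "2 * dist z \<xi> < r"
    and f': "(f has_derivative f') (at z)" "\<And>c v. f' (c *s v) = c * f' v"
  shows "sderiv \<mu> z = norm (f' (F z *v axis \<mu> 1)) / (1 + (norm (f z))\<^sup>2)"
  unfolding spherical_derivative_def Let_def
  using complex_partial_frame[OF frame_facts(1)[OF z] f'] by simp

lemma sderiv_nonneg: "sderiv \<mu> z \<ge> 0"
  by (simp add: spherical_derivative_def Let_def add_pos_nonneg)

section \<open>From an admissible limit to the decay of the spherical derivatives\<close>

lemma holo_derivative:
  assumes "z \<in> D"
  obtains f' where "(f has_derivative f') (at z)" "\<And>c v. f' (c *s v) = c * f' v"
  using f_holo assms unfolding holomorphic_Cn_on_def by blast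

text \<open>Along the first frame vector the radius is already of order d. Any other frame vector
  has first coordinate O(|z - \<xi>|) = O(sqrt d) in the coordinates at \<xi>, so a radius of order
  sqrt d moves that coordinate only by O(d). Thus \<open>admissible_perturb\<close> applies in both
  cases.\<close>

lemma disc_in_region:
  assumes \<alpha>: "\<alpha> > 0"
  obtains c \<beta> \<delta> where "c > 0" "\<beta> > 0" "\<delta> > 0"
    "\<And>z \<mu> s. \<lbrakk>z \<in> region \<alpha>; dist z \<xi> < \<delta>;
        norm s \<le> c * (if \<mu> = i0 then depth (coords z) else sqrt (depth (coords z)))\<rbrakk> \<Longrightarrow>
      z + s *s (F z *v axis \<mu> 1) \<in> region \<beta> \<and>
      dist (z + s *s (F z *v axis \<mu> 1)) \<xi> \<le> 2 * sqrt (dist z \<xi>)"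
proof -
  obtain c' \<beta> \<delta>' where c': "c' > 0" and \<beta>: "\<beta> > 0" and \<delta>': "\<delta>' > 0" and
    perturb: "\<And>w v. \<lbrakk>norm w < \<delta>'; admissible \<alpha> w; norm (v - w) \<le> c' * sqrt (depth w);
        norm (v $ i0 - w $ i0) \<le> c' * depth w\<rbrakk> \<Longrightarrow> admissible \<beta> v \<and> norm v \<le> 2 * sqrt (norm w)"
    using admissible_perturb[OF \<alpha>] by blast
  \<comment> \<open>The second bound absorbs the constant in the estimate of the first coordinate
    for tangent directions.\<close>
  define c where "c = min c' (c' / (4 * C * sqrt \<alpha>))"
  have "c \<le> c' / (4 * C * sqrt \<alpha>)" by (simp add: c_def)
  then have "c * (4 * C * sqrt \<alpha>) \<le> c'"
    using C \<alpha> by (simp add: pos_le_divide_eq)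
  moreover have "c > 0" "c \<le> c'" using c' C \<alpha> by (auto simp: c_def)
  ultimately have c: "c > 0" "c \<le> c'" "c * (4 * C * sqrt \<alpha>) \<le> c'" by auto
  \<comment> \<open>In turn: the range of the perturbation estimate, a depth at most 1 so that d
    \<le> sqrt d, the range of the frame estimates, and discs within distance \<open>r\<close> of
    \<xi>.\<close>
  define \<delta> where "\<delta> = Min {\<delta>', 1, r / 2, (r / 2)\<^sup>2}"
  have \<delta>: "\<delta> > 0" "\<delta> \<le> \<delta>'" "\<delta> \<le> 1" "\<delta> \<le> r / 2" "\<delta> \<le> (r / 2)\<^sup>2"
    using \<delta>' r by (auto simp: \<delta>_def)
  show thesis
  proof (rule that[OF c(1) \<beta> \<delta>(1)])
    fix z \<mu> and s :: complex
    assume z: "z \<in> region \<alpha>" "dist z \<xi> < \<delta>"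
      and s: "norm s \<le> c * (if \<mu> = i0 then depth (coords z) else sqrt (depth (coords z)))"
    have zr: "2 * dist z \<xi> < r" using z(2) \<delta> by simp
    have zDV: "z \<in> D \<inter> V" and adm: "admissible \<alpha> (coords z)" using z(1) by (auto simp: region_iff)
    define w where "w = coords z"
    define d where "d = depth w"
    have d: "0 < d" "d \<le> 1" "sqrt d \<le> 1"
      using admissible_depth_pos[OF adm \<alpha>] depth_le(2)[of w] z(2) \<delta>(3)
      by (auto simp: d_def w_def norm_coords)
    have dd: "d \<le> sqrt d"
      using d by (intro real_le_rsqrt) (simp add: power2_eq_square mult_left_le_one_le)
    define m where "m = frame z *v axis \<mu> 1"
    have m1: "norm m = 1"
      using unitary_norm[OF frame_facts(2)[OF zDV zr], of "axis \<mu> 1"]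
      by (simp add: m_def norm_eq_sqrt_inner inner_axis_axis)
    define v where "v = w + s *s m"
    have nsm: "norm (s *s m) = norm s"
      using m1 by (simp add: norm_vec_def norm_mult L2_set_right_distrib[symmetric])
    have s1: "norm s \<le> c * sqrt d"
      using s mult_left_mono[OF dd less_imp_le[OF c(1)]] order_trans
      by (fastforce simp: d_def[symmetric] w_def[symmetric] split: if_splits)
    have s2: "norm (s * m $ i0) \<le> c' * d"
    proof (cases "\<mu> = i0")
      case True
      have "norm (m $ i0) \<le> 1" using m1 Finite_Cartesian_Product.norm_nth_le[of m i0] by simp
      then have "norm (s * m $ i0) \<le> norm s" by (simp add: norm_mult mult_left_le)
      also have "\<dots> \<le> c * d" using s True by (simp add: d_def w_def)
      also have "\<dots> \<le> c' * d" using c(2) d by (intro mult_right_mono) auto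
      finally show ?thesis .
    next
      case False
      \<comment> \<open>In its own frame \<open>m\<close> is an axis vector with vanishing first
        coordinate, so only the error of the frame comparison remains.\<close>
      have "norm (m $ i0) \<le> 4 * C * norm w"
        using frame_facts(5)[OF zDV zr, of m] False m1
        by (simp add: m_def unitary_cancel[OF frame_facts(2)[OF zDV zr]] axis_def w_def norm_coords)
      also have "\<dots> \<le> 4 * C * (sqrt \<alpha> * sqrt d)"
        using admissible_norm_le[OF adm \<alpha>] C by (simp add: d_def w_def)
      finally have "norm (s * m $ i0) \<le> (c * sqrt d) * (4 * C * (sqrt \<alpha> * sqrt d))"
        unfolding norm_mult using s1 C \<alpha> c d by (intro mult_mono) auto
      also have "\<dots> = c * (4 * C * sqrt \<alpha>) * d" using d by simp
      also have "\<dots> \<le> c' * d" using c(3) d by (intro mult_right_mono) auto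
      finally show ?thesis .
    qed
    have v: "admissible \<beta> v" "norm v \<le> 2 * sqrt (norm w)"
    proof -
      have "admissible \<beta> v \<and> norm v \<le> 2 * sqrt (norm w)"
      proof (rule perturb)
        show "norm w < \<delta>'" using z(2) \<delta>(2) by (simp add: w_def norm_coords)
        show "admissible \<alpha> w" using adm by (simp add: w_def)
        show "norm (v - w) \<le> c' * sqrt (depth w)"
          using order_trans[OF s1 mult_right_mono[OF c(2)]] nsm d by (simp add: v_def d_def)
        show "norm (v $ i0 - w $ i0) \<le> c' * depth w" using s2 by (simp add: v_def d_def)
      qed
      then show "admissible \<beta> v" "norm v \<le> 2 * sqrt (norm w)" by auto
    qed
    define y where "y = z + s *s (F z *v axis \<mu> 1)"
    have "from_coords \<xi> W v = from_coords \<xi> W w + s *s (F z *v axis \<mu> 1)"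
      using frame_facts(3)[OF zDV zr, of "axis \<mu> 1"]
      by (simp add: v_def m_def from_coords_def matrix_vector_right_distrib vector_scalar_commute)
    then have y: "y = from_coords \<xi> W v" by (simp add: y_def w_def from_coords_to_coords[OF W])
    then have cy: "coords y = v" by (simp add: to_coords_from_coords[OF W])
    then have y\<xi>: "dist y \<xi> \<le> 2 * sqrt (dist z \<xi>)"
      using v(2) norm_coords[of y] by (simp add: w_def norm_coords)
    have "sqrt (dist z \<xi>) < r / 2" using z(2) \<delta>(5) r by (intro real_less_lsqrt) auto
    then have "dist y \<xi> < r" using y\<xi> by simp
    then show "z + s *s (F z *v axis \<mu> 1) \<in> region \<beta> \<and>
      dist (z + s *s (F z *v axis \<mu> 1)) \<xi> \<le> 2 * sqrt (dist z \<xi>)"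
      using region_near_iff[OF _ \<beta>, of y] v(1) cy y\<xi> by (simp add: y_def)
  qed
qed

text \<open>Cauchy's estimate is applied on a disc whose radius is \<open>c\<close> times the
  weight; the disc stays in a fixed admissible domain, where \<open>f\<close> is already close to
  \<open>L\<close>.\<close>

lemma sderiv_tendsto:
  assumes lim: "has_admissible_limit i0 D \<xi> W \<psi> V f L" and \<alpha>: "\<alpha> > 0"
  shows "((\<lambda>z. (if \<mu> = i0 then depth (coords z) else sqrt (depth (coords z))) * sderiv \<mu> z) \<longlongrightarrow> 0)
    (at \<xi> within region \<alpha>)"
proof -
  obtain c \<beta> \<delta>0 where c: "c > 0" and \<beta>: "\<beta> > 0" and \<delta>0: "\<delta>0 > 0" and
    disc: "\<And>z \<mu> s. \<lbrakk>z \<in> region \<alpha>; dist z \<xi> < \<delta>0;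
        norm s \<le> c * (if \<mu> = i0 then depth (coords z) else sqrt (depth (coords z)))\<rbrakk> \<Longrightarrow>
      z + s *s (F z *v axis \<mu> 1) \<in> region \<beta> \<and>
      dist (z + s *s (F z *v axis \<mu> 1)) \<xi> \<le> 2 * sqrt (dist z \<xi>)"
    using disc_in_region[OF \<alpha>] by blast
  define size where "size z = (if \<mu> = i0 then depth (coords z) else sqrt (depth (coords z)))" for z
  show ?thesis unfolding size_def[symmetric]
  proof (rule tendstoI)
    fix e :: real assume e: "e > 0"
    \<comment> \<open>Dividing the estimate by \<open>c\<close> will leave e / 2 < e.\<close>
    define \<epsilon> where "\<epsilon> = c * e / 2"
    have \<epsilon>: "\<epsilon> > 0" using c e by (simp add: \<epsilon>_def)
    have "tendsto_sphere f L (at \<xi> within region \<beta>)"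
      using lim \<beta> by (simp add: has_admissible_limit_def)
    then have "\<forall>\<^sub>F z in at \<xi> within region \<beta>. f z \<in> sphere_nbhd L \<epsilon>"
      using \<epsilon> by (rule tendsto_sphere_nbhd)
    then obtain \<eta> where \<eta>: "\<eta> > 0"
      "\<And>z. z \<in> region \<beta> \<Longrightarrow> z \<noteq> \<xi> \<Longrightarrow> dist z \<xi> < \<eta> \<Longrightarrow> f z \<in> sphere_nbhd L \<epsilon>"
      unfolding eventually_at by blast
    \<comment> \<open>Points of the disc are within 2 sqrt(dist z \<xi>) of \<xi>; the last bound
      makes this smaller than \<eta>.\<close>
    define \<delta> where "\<delta> = Min {\<delta>0, r / 2, (\<eta> / 2)\<^sup>2}"
    have \<delta>: "\<delta> > 0" "\<delta> \<le> \<delta>0" "\<delta> \<le> r / 2" "\<delta> \<le> (\<eta> / 2)\<^sup>2"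
      using \<delta>0 r \<eta>(1) by (auto simp: \<delta>_def)
    have "dist (size z * sderiv \<mu> z) 0 < e" if z: "z \<in> region \<alpha>" "dist z \<xi> < \<delta>" for z
    proof -
      have zDV: "z \<in> D \<inter> V" and adm: "admissible \<alpha> (coords z)" using z(1) by (auto simp: region_iff)
      have zr: "2 * dist z \<xi> < r" using z(2) \<delta> by simp
      have size: "size z > 0" using admissible_depth_pos[OF adm \<alpha>] by (simp add: size_def)
      define u where "u = F z *v axis \<mu> 1"
      define h where "h s = f (z + s *s u)" for s
      have in_region: "z + s *s u \<in> region \<beta>" "dist (z + s *s u) \<xi> < \<eta>"
        if "s \<in> cball 0 (c * size z)" for s :: complex
      proof -
        have *: "z + s *s u \<in> region \<beta> \<and> dist (z + s *s u) \<xi> \<le> 2 * sqrt (dist z \<xi>)"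
          unfolding u_def using that z(2) \<delta>(2) by (intro disc[OF z(1)]) (auto simp: size_def)
        moreover have "sqrt (dist z \<xi>) < \<eta> / 2"
          using z(2) \<delta>(4) \<eta>(1) by (intro real_less_lsqrt) auto
        ultimately show "z + s *s u \<in> region \<beta>" "dist (z + s *s u) \<xi> < \<eta>" by auto
      qed
      have h_der: "(h has_field_derivative f' u) (at s)"
        if f': "(f has_derivative f') (at (z + s *s u))" "\<And>c v. f' (c *s v) = c * f' v" for f' s
      proof -
        have "((\<lambda>s. z + s *s u) has_derivative (\<lambda>t. t *s u)) (at s)"
          by (auto intro!: derivative_eq_intros
              bounded_linear_imp_has_derivative[OF bounded_linear_vector_scalar])
        then have "(h has_derivative (\<lambda>t. f' (t *s u))) (at s)"
          unfolding h_def[abs_def] using f'(1) by (rule has_derivative_compose)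
        then show ?thesis by (simp add: has_field_derivative_def f'(2) mult_commute_abs)
      qed
      have "c * size z * (norm (deriv h 0) / (1 + (norm (h 0))\<^sup>2)) \<le> \<epsilon>"
      proof (rule spherical_Cauchy_estimate[OF _ \<epsilon>])
        show "c * size z > 0" using c size by simp
        fix s :: complex assume s: "s \<in> cball 0 (c * size z)"
        have "z + s *s u \<in> D" using in_region(1)[OF s] by (simp add: region_iff)
        then show "h field_differentiable at s"
          by (metis holo_derivative h_der field_differentiable_def)
        \<comment> \<open>The limit is a punctured one, but a frontier point of an open set is not
          in the set.\<close>
        have "z + s *s u \<noteq> \<xi>"
          using \<open>z + s *s u \<in> D\<close> \<xi> D_open by (auto simp: frontier_def interior_open)
        then show "h s \<in> sphere_nbhd L \<epsilon>"
          using \<eta>(2) in_region[OF s] by (simp add: h_def)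
      qed
      moreover obtain f' where f': "(f has_derivative f') (at z)" "\<And>c v. f' (c *s v) = c * f' v"
        using holo_derivative zDV by blast
      have "deriv h 0 = f' u" using h_der[of f' 0] f' by (intro DERIV_imp_deriv) simp
      then have "sderiv \<mu> z = norm (deriv h 0) / (1 + (norm (h 0))\<^sup>2)"
        by (simp add: sderiv_eq[OF zDV zr f'] h_def u_def)
      ultimately have "c * (size z * sderiv \<mu> z) \<le> c * (e / 2)" by (simp add: \<epsilon>_def mult.assoc)
      then have "size z * sderiv \<mu> z \<le> e / 2" using c by simp
      then show ?thesis using size sderiv_nonneg[of \<mu> z] e by (simp add: abs_mult)
    qed
    then show "\<forall>\<^sub>F z in at \<xi> within region \<alpha>. dist (size z * sderiv \<mu> z) 0 < e"
      unfolding eventually_at using \<delta>(1) by blast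
  qed
qed

text \<open>The path keeps the real part x of the first coordinate, which is comparable with the
  depth at each of its points. The velocity has norm O(sqrt x) and normal component O(x), so both
  can be measured by the depth at the current point \<open>y\<close>; expanding in the frame at
  \<open>y\<close> produces the weighted spherical derivatives.\<close>

lemma path_derivative_bound:
  assumes \<alpha>: "\<alpha> > 0"
  obtains B \<delta> where "B > 0" "\<delta> > 0"
    "\<And>z t y f'. \<lbrakk>z \<in> region \<alpha>; dist z \<xi> < \<delta>; t \<in> {0..1};
       y = from_coords \<xi> W (shrink t (coords z));
       (f has_derivative f') (at y); \<And>c v. f' (c *s v) = c * f' v\<rbrakk> \<Longrightarrow>
       norm (f' (W *v zeta_part i0 (coords z))) / (1 + (norm (f y))\<^sup>2) \<le>
       B * (\<Sum>\<mu>\<in>UNIV. (if \<mu> = i0 then depth (coords y) else sqrt (depth (coords y))) * sderiv \<mu> y)"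
    "\<And>z t y. \<lbrakk>z \<in> region \<alpha>; dist z \<xi> < \<delta>; t \<in> {0..1};
       y = from_coords \<xi> W (shrink t (coords z))\<rbrakk> \<Longrightarrow> y \<in> region (2 * \<alpha>) \<and> dist y \<xi> \<le> dist z \<xi>"
proof -
  obtain \<delta>1 where \<delta>1: "\<delta>1 > 0" and
    shrink: "\<And>w t. \<lbrakk>norm w < \<delta>1; admissible \<alpha> w; 0 \<le> t; t \<le> 1\<rbrakk> \<Longrightarrow> admissible (2 * \<alpha>) (shrink t w)"
    using admissible_shrink[OF \<alpha>] by blast
  define \<delta> where "\<delta> = min \<delta>1 (r / 2)"
  have \<delta>: "\<delta> > 0" "\<delta> \<le> \<delta>1" "\<delta> \<le> r / 2" using \<delta>1 r by (auto simp: \<delta>_def)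
  \<comment> \<open>The second factor compares the real part with the depth at aperture 2\<alpha>;
    the factor \<alpha> comes from the admissibility of the endpoint.\<close>
  define K where "K = \<alpha> * (1 + C * (2 * \<alpha>))"
  have K: "K > 0" using \<alpha> C by (simp add: K_def add_pos_pos)
  \<comment> \<open>The first summand serves the normal component, including the error of the frame
    change, the second one the tangential components.\<close>
  define B where "B = K * (1 + 4 * C) + sqrt K"
  have B: "B > 0" "K * (1 + 4 * C) \<le> B" "sqrt K \<le> B"
    using K C by (auto simp: B_def add_pos_pos)
  have region: "y \<in> region (2 * \<alpha>) \<and> dist y \<xi> \<le> dist z \<xi>"
    if z: "z \<in> region \<alpha>" "dist z \<xi> < \<delta>" and t: "t \<in> {0..1}"
      and y: "y = from_coords \<xi> W (shrink t (coords z))" for z t y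
  proof
    have cy: "coords y = shrink t (coords z)" by (simp add: y to_coords_from_coords[OF W])
    show yz: "dist y \<xi> \<le> dist z \<xi>"
      using norm_shrink_le[of t "coords z"] t by (simp add: norm_coords[symmetric] cy)
    have "admissible (2 * \<alpha>) (coords y)"
      unfolding cy using z t \<delta> by (intro shrink) (auto simp: norm_coords region_iff)
    then show "y \<in> region (2 * \<alpha>)" using region_near_iff[of y "2 * \<alpha>"] yz z(2) \<delta> r \<alpha> by simp
  qed
  show thesis
  proof (rule that[OF B(1) \<delta>(1) _ region])
    fix z t y f'
    assume z: "z \<in> region \<alpha>" "dist z \<xi> < \<delta>" and t: "t \<in> {0..1}"
      and y: "y = from_coords \<xi> W (shrink t (coords z))"
      and f': "(f has_derivative f') (at y)" "\<And>c v. f' (c *s v) = c * f' v"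
    define w where "w = coords z"
    define v where "v = zeta_part i0 w"
    define d where "d = depth (coords y)"
    define a where "a = adjoint_matrix (frame y) *v v"
    have y2: "y \<in> region (2 * \<alpha>)" "dist y \<xi> \<le> dist z \<xi>" using region[OF z t y] by auto
    have yDV: "y \<in> D \<inter> V" and yadm: "admissible (2 * \<alpha>) (coords y)" using y2 by (auto simp: region_iff)
    have yr: "2 * dist y \<xi> < r" using y2(2) z(2) \<delta> by linarith
    have cy: "coords y = shrink t w" by (simp add: y w_def to_coords_from_coords[OF W])
    have adm: "admissible \<alpha> w" using z(1) by (simp add: region_iff w_def)
    have d: "d > 0" using admissible_depth_pos[OF yadm] \<alpha> by (simp add: d_def)
    have "Re (coords y $ i0) \<le> (1 + C * (2 * \<alpha>)) * d"
      unfolding d_def using yr \<alpha> r by (intro admissible_Re_le_depth[OF yadm]) (auto simp: norm_coords)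
    \<comment> \<open>The real part is the same at \<open>y\<close> and \<open>z\<close>, so the
      inequalities for \<open>w\<close> become bounds by the depth at \<open>y\<close>.\<close>
    then have xK: "\<alpha> * Re (w $ i0) \<le> K * d"
      using \<alpha> by (simp add: cy shrink_component K_def mult.assoc)
    have v1: "norm (v $ i0) \<le> K * d"
    proof -
      have "norm (v $ i0) = \<bar>Im (w $ i0)\<bar>" by (simp add: v_def zeta_part_def cmod_def)
      then show ?thesis using adm xK unfolding admissible_def by linarith
    qed
    have "(norm w)\<^sup>2 \<le> \<alpha> * Re (w $ i0)"
      using adm mult_left_mono[OF depth_le(1)[of w] less_imp_le[OF \<alpha>]]
      unfolding admissible_def by linarith
    then have wK: "(norm w)\<^sup>2 \<le> K * d" using xK by simp
    then have "norm w \<le> sqrt K * sqrt d" by (simp add: real_le_rsqrt real_sqrt_mult[symmetric])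
    then have vK: "norm v \<le> sqrt K * sqrt d"
      using norm_zeta_part_le[of w] by (simp add: v_def)
    have a: "norm (a $ \<mu>) \<le> B * (if \<mu> = i0 then d else sqrt d)" for \<mu>
    proof (cases "\<mu> = i0")
      case True
      have "norm v * (4 * C * dist y \<xi>) \<le> norm w * (4 * C * norm w)"
        using norm_zeta_part_le[of w] y2(2) C
        by (intro mult_mono) (auto simp: v_def w_def norm_coords)
      also have "\<dots> \<le> 4 * C * (K * d)"
        using mult_left_mono[OF wK, of "4 * C"] C by (simp add: power2_eq_square mult_ac)
      finally have "norm (a $ i0) \<le> K * (1 + 4 * C) * d"
        using frame_facts(4)[OF yDV yr, of v] v1 by (simp add: a_def algebra_simps)
      also have "\<dots> \<le> B * d" using B(2) d by (intro mult_right_mono) auto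
      finally show ?thesis using True by simp
    next
      case False
      have "norm (a $ \<mu>) \<le> norm a" by (rule Finite_Cartesian_Product.norm_nth_le)
      also have "\<dots> = norm v"
        unfolding a_def by (intro unitary_norm unitary_adjoint frame_facts(2)[OF yDV yr])
      also have "\<dots> \<le> B * sqrt d"
        using order_trans[OF vK mult_right_mono[OF B(3)]] d by simp
      finally show ?thesis using False by simp
    qed
    \<comment> \<open>The velocity is expanded in the frame at \<open>y\<close>, so that complex
      linearity splits its derivative into those along the frame vectors.\<close>
    have "W *v v = F y *v a"
      using frame_facts(3)[OF yDV yr, of a] unitary_cancel(2)[OF frame_facts(2)[OF yDV yr], of v]
      by (simp add: a_def)
    also have "a = (\<Sum>\<mu>\<in>UNIV. a $ \<mu> *s axis \<mu> 1)" by (rule vector_expansion)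
    finally have Wv: "W *v v = F y *v (\<Sum>\<mu>\<in>UNIV. a $ \<mu> *s axis \<mu> 1)" .
    have lin: "linear (\<lambda>x. f' (F y *v x))"
      by (rule bounded_linear.linear[OF bounded_linear_compose[OF
        has_derivative_bounded_linear[OF f'(1)] bounded_linear_matrix_vector]])
    have "f' (W *v v) = (\<Sum>\<mu>\<in>UNIV. a $ \<mu> * f' (F y *v axis \<mu> 1))"
      unfolding Wv linear_sum[OF lin] by (simp add: vector_scalar_commute f'(2))
    then have "norm (f' (W *v v)) \<le> (\<Sum>\<mu>\<in>UNIV. norm (a $ \<mu>) * norm (f' (F y *v axis \<mu> 1)))"
      by (simp add: sum_norm_le norm_mult)
    then have "norm (f' (W *v v)) / (1 + (norm (f y))\<^sup>2) \<le>
        (\<Sum>\<mu>\<in>UNIV. norm (a $ \<mu>) * norm (f' (F y *v axis \<mu> 1))) / (1 + (norm (f y))\<^sup>2)"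
      by (rule divide_right_mono) simp
    also have "\<dots> = (\<Sum>\<mu>\<in>UNIV. norm (a $ \<mu>) * sderiv \<mu> y)"
      by (simp add: sum_divide_distrib sderiv_eq[OF yDV yr f'])
    also have "\<dots> \<le> (\<Sum>\<mu>\<in>UNIV. B * (if \<mu> = i0 then d else sqrt d) * sderiv \<mu> y)"
      by (intro sum_mono mult_right_mono a sderiv_nonneg)
    finally show "norm (f' (W *v zeta_part i0 (coords z))) / (1 + (norm (f y))\<^sup>2) \<le>
       B * (\<Sum>\<mu>\<in>UNIV. (if \<mu> = i0 then depth (coords y) else sqrt (depth (coords y))) * sderiv \<mu> y)"
      unfolding v_def w_def d_def by (simp add: sum_distrib_left mult.assoc)
  qed
qed

text \<open>The initial point of the path is \<xi> - x \<nu>, where x is the real part of the first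
  coordinate of z; x tends to 0 through positive values because it dominates the depth.\<close>

lemma axis_tendsto_sphere:
  assumes "has_normal_limit f \<xi> \<nu> L" and "W *v axis i0 1 = - \<nu>" and "\<alpha> > 0"
  shows "tendsto_sphere (\<lambda>z. f (from_coords \<xi> W (shrink 0 (coords z)))) L (at \<xi> within region \<alpha>)"
proof -
  have "from_coords \<xi> W (shrink 0 w) = \<xi> - Re (w $ i0) *\<^sub>R \<nu>" for w
    by (simp add: from_coords_def shrink_def matrix_vector_scaleR assms(2))
  moreover have "filterlim (\<lambda>z. Re (coords z $ i0)) (at_right 0) (at \<xi> within region \<alpha>)"
    unfolding filterlim_at
  proof
    have "(\<lambda>z. Re (coords z $ i0)) \<midarrow>\<xi>\<rightarrow> 0"
    proof (rule Lim_null_comparison)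
      show "\<forall>\<^sub>F z in at \<xi>. norm (Re (coords z $ i0)) \<le> dist z \<xi>"
        using order_trans[OF abs_Re_le_cmod Finite_Cartesian_Product.norm_nth_le]
        by (intro always_eventually allI) (simp add: norm_coords[symmetric])
      show "(\<lambda>z. dist z \<xi>) \<midarrow>\<xi>\<rightarrow> 0" using tendsto_dist[OF tendsto_ident_at[of \<xi>] tendsto_const[of \<xi>]] by simp
    qed
    then show "((\<lambda>z. Re (coords z $ i0)) \<longlongrightarrow> 0) (at \<xi> within region \<alpha>)"
      by (rule tendsto_within_subset) simp
    show "\<forall>\<^sub>F z in at \<xi> within region \<alpha>. Re (coords z $ i0) \<in> {0<..} \<and> Re (coords z $ i0) \<noteq> 0"
      unfolding eventually_at_filter
    proof (intro always_eventually allI impI)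
      fix z assume "z \<in> region \<alpha>"
      then have "depth (coords z) > 0" using admissible_depth_pos[OF _ assms(3)] by (simp add: region_iff)
      then show "Re (coords z $ i0) \<in> {0<..} \<and> Re (coords z $ i0) \<noteq> 0"
        using depth_le(1)[of "coords z"] by simp
    qed
  qed
  ultimately show ?thesis
    using assms(1) unfolding has_normal_limit_def
    using tendsto_sphere_compose[of "\<lambda>t. f (\<xi> - t *\<^sub>R \<nu>)" L] by simp
qed

text \<open>The image of the path has spherical speed tending to 0, so its endpoints have the same
  limit on the sphere. As the path runs in the domain of aperture 2\<alpha>, the decay is invoked
  there.\<close>

lemma admissible_limit_if_sderiv_tendsto:
  assumes "has_normal_limit f \<xi> \<nu> L" and "W *v axis i0 1 = - \<nu>"
    and small: "\<And>\<alpha> \<mu>. \<alpha> > 0 \<Longrightarrow>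
      ((\<lambda>z. (if \<mu> = i0 then depth (coords z) else sqrt (depth (coords z))) * sderiv \<mu> z) \<longlongrightarrow> 0)
        (at \<xi> within region \<alpha>)"
  shows "has_admissible_limit i0 D \<xi> W \<psi> V f L"
  unfolding has_admissible_limit_def
proof (intro allI impI)
  fix \<alpha> :: real assume \<alpha>: "\<alpha> > 0"
  define S where "S y = (\<Sum>\<mu>\<in>UNIV.
      (if \<mu> = i0 then depth (coords y) else sqrt (depth (coords y))) * sderiv \<mu> y)" for y
  define P where "P z = f (from_coords \<xi> W (shrink 0 (coords z)))" for z
  obtain B \<delta> where B: "B > 0" and \<delta>: "\<delta> > 0" and
    bound: "\<And>z t y f'. \<lbrakk>z \<in> region \<alpha>; dist z \<xi> < \<delta>; t \<in> {0..1};
       y = from_coords \<xi> W (shrink t (coords z));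
       (f has_derivative f') (at y); \<And>c v. f' (c *s v) = c * f' v\<rbrakk> \<Longrightarrow>
       norm (f' (W *v zeta_part i0 (coords z))) / (1 + (norm (f y))\<^sup>2) \<le> B * S y" and
    path: "\<And>z t y. \<lbrakk>z \<in> region \<alpha>; dist z \<xi> < \<delta>; t \<in> {0..1};
       y = from_coords \<xi> W (shrink t (coords z))\<rbrakk> \<Longrightarrow> y \<in> region (2 * \<alpha>) \<and> dist y \<xi> \<le> dist z \<xi>"
    using path_derivative_bound[OF \<alpha>] unfolding S_def by blast
  obtain Df where Df: "\<And>z. z \<in> D \<Longrightarrow> (f has_derivative Df z) (at z)"
    "\<And>z c v. z \<in> D \<Longrightarrow> Df z (c *s v) = c * Df z v"
    using f_holo unfolding holomorphic_Cn_on_def by metis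
  have S: "(S \<longlongrightarrow> 0) (at \<xi> within region (2 * \<alpha>))"
    unfolding S_def[abs_def] using \<alpha> by (intro tendsto_null_sum small) auto
  have close: "\<forall>\<^sub>F z in at \<xi> within region \<alpha>.
      \<bar>sphere_height (f z) - sphere_height (P z)\<bar> < e \<and>
      norm (sphere_shadow (f z) - sphere_shadow (P z)) < e" if e: "e > 0" for e
  proof -
    \<comment> \<open>The speed is then at most e / 4, and the shadow, the worse of the two
      coordinates, moves by at most 3e / 4 < e.\<close>
    define \<epsilon> where "\<epsilon> = e / (4 * B)"
    have "\<epsilon> > 0" using e B by (simp add: \<epsilon>_def)
    then have "\<forall>\<^sub>F y in at \<xi> within region (2 * \<alpha>). S y < \<epsilon>" using S by (intro order_tendstoD)
    then obtain \<eta> where \<eta>: "\<eta> > 0"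
      "\<And>y. y \<in> region (2 * \<alpha>) \<Longrightarrow> y \<noteq> \<xi> \<Longrightarrow> dist y \<xi> < \<eta> \<Longrightarrow> S y < \<epsilon>"
      unfolding eventually_at by blast
    have "\<bar>sphere_height (f z) - sphere_height (P z)\<bar> < e \<and>
      norm (sphere_shadow (f z) - sphere_shadow (P z)) < e"
      if z: "z \<in> region \<alpha>" "dist z \<xi> < min \<delta> \<eta>" for z
    proof -
      define w where "w = coords z"
      define v where "v = W *v zeta_part i0 w"
      define \<gamma> where "\<gamma> t = from_coords \<xi> W (shrink t w)" for t
      have \<gamma>: "\<gamma> t \<in> region (2 * \<alpha>)" "dist (\<gamma> t) \<xi> \<le> dist z \<xi>" if "t \<in> {0..1}" for t
        using path[OF z(1) _ that, of "\<gamma> t"] z(2) by (auto simp: \<gamma>_def w_def)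
      have \<gamma>D: "\<gamma> t \<in> D" if "t \<in> {0..1}" for t using \<gamma>(1)[OF that] by (simp add: region_iff)
      have \<gamma>_der: "(\<gamma> has_derivative (\<lambda>s. s *\<^sub>R v)) (at t within {0..1})" for t
      proof -
        have "\<gamma> = (\<lambda>t. \<xi> + Re (w $ i0) *\<^sub>R (W *v axis i0 1) + t *\<^sub>R v)"
          by (simp add: \<gamma>_def fun_eq_iff from_coords_def shrink_def v_def matrix_vector_right_distrib
              matrix_vector_scaleR)
        then show ?thesis by (auto intro!: derivative_eq_intros)
      qed
      have der: "((\<lambda>t. f (\<gamma> t)) has_vector_derivative Df (\<gamma> t) v) (at t within {0..1})"
        if t: "t \<in> {0..1}" for t
        using has_derivative_compose[OF \<gamma>_der Df(1)[OF \<gamma>D[OF t]]]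
          linear_scale[OF has_derivative_linear[OF Df(1)[OF \<gamma>D[OF t]]]]
        by (simp add: has_vector_derivative_def)
      have le: "norm (Df (\<gamma> t) v) / (1 + (norm (f (\<gamma> t)))\<^sup>2) \<le> e / 4" if t: "t \<in> {0..1}" for t
      proof -
        have "norm (Df (\<gamma> t) v) / (1 + (norm (f (\<gamma> t)))\<^sup>2) \<le> B * S (\<gamma> t)"
          unfolding v_def w_def
          using z Df[OF \<gamma>D[OF t]] by (intro bound[OF z(1) _ t]) (auto simp: \<gamma>_def w_def)
        also have "\<dots> \<le> B * \<epsilon>"
        proof (rule mult_left_mono)
          show "S (\<gamma> t) \<le> \<epsilon>"
            using \<eta>(2)[of "\<gamma> t"] \<gamma>[OF t] z(2) \<gamma>D[OF t] \<xi> D_open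
            by (force simp: frontier_def interior_open)
        qed (use B in simp)
        finally show ?thesis using B by (simp add: \<epsilon>_def)
      qed
      have "\<gamma> 1 = z" by (simp add: \<gamma>_def shrink_1 w_def from_coords_to_coords[OF W])
      moreover have "f (\<gamma> 0) = P z" by (simp add: \<gamma>_def P_def w_def)
      ultimately show ?thesis
        using spherical_curve_bound[of "\<lambda>t. f (\<gamma> t)" "\<lambda>t. Df (\<gamma> t) v" "e / 4", OF der le] e by simp
    qed
    moreover have "min \<delta> \<eta> > 0" using \<delta> \<eta>(1) by simp
    ultimately show ?thesis unfolding eventually_at by blast
  qed
  show "tendsto_sphere f L (at \<xi> within region \<alpha>)"
  proof (rule tendsto_sphere_transfer)
    show "tendsto_sphere P L (at \<xi> within region \<alpha>)"
      unfolding P_def[abs_def] by (rule axis_tendsto_sphere[OF assms(1,2) \<alpha>])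
    show "((\<lambda>z. sphere_height (f z) - sphere_height (P z)) \<longlongrightarrow> 0) (at \<xi> within region \<alpha>)"
      by (rule tendstoI) (use close in \<open>force elim: eventually_mono\<close>)
    show "((\<lambda>z. sphere_shadow (f z) - sphere_shadow (P z)) \<longlongrightarrow> 0) (at \<xi> within region \<alpha>)"
      by (rule tendstoI) (use close in \<open>force elim: eventually_mono\<close>)
  qed
qed

end

section \<open>Local data at \<xi> and the combination of both implications\<close>

theorem theorem2p4:
  fixes D V :: "(complex ^ 'n) set"
    and \<xi> \<nu> :: "complex ^ 'n"
    and f :: "complex ^ 'n \<Rightarrow> complex"
    and i0 :: 'n
    and W :: "complex ^ 'n ^ 'n"
    and \<psi> :: "complex ^ 'n \<Rightarrow> real"
    and F :: "complex ^ 'n \<Rightarrow> complex ^ 'n ^ 'n"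
  assumes "CARD('n) > 1"
    and "open D" and "connected D" and "C2_boundary D"
    and "\<xi> \<in> frontier D"
    and "outward_unit_normal D \<xi> \<nu>"
    and "adapted_frame i0 (- \<nu>) W"
    and "graph_neighbourhood i0 D \<xi> W \<psi> V"
    and "moving_frame i0 D V F"
    and "holomorphic_Cn_on f D"
    and "\<exists>L. has_normal_limit f \<xi> \<nu> L"
  shows "(\<exists>L. has_admissible_limit i0 D \<xi> W \<psi> V f L) \<longleftrightarrow>
    (\<forall>\<alpha>>0.
      ((\<lambda>z. boundary_d i0 \<xi> W \<psi> z * spherical_derivative D F f i0 z) \<longlongrightarrow> 0)
        (at \<xi> within admissible_domain i0 D \<xi> W \<psi> V \<alpha>) \<and>
      (\<forall>\<mu>. \<mu> \<noteq> i0 \<longrightarrow>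
        ((\<lambda>z. sqrt (boundary_d i0 \<xi> W \<psi> z) * spherical_derivative D F f \<mu> z) \<longlongrightarrow> 0)
          (at \<xi> within admissible_domain i0 D \<xi> W \<psi> V \<alpha>)))"
proof -
  have W_frame: "unitary_matrix W" "W *v axis i0 1 = - \<nu>"
    using assms(7) by (auto simp: adapted_frame_def)
  have V: "open V" "\<xi> \<in> V" and \<psi>0: "\<psi> 0 = 0" "GDERIV (\<lambda>w. \<psi> (zeta_part i0 w)) 0 :> 0"
    using assms(8) by (auto simp: graph_neighbourhood_def)
  obtain N where N: "open N" "closure V \<subseteq> N"
    and C2: "C2_on (\<lambda>w. \<psi> (zeta_part i0 w)) (to_coords \<xi> W ` N)"
    and graph: "\<And>z. z \<in> N \<Longrightarrow>
      (z \<in> D \<longleftrightarrow> Re (to_coords \<xi> W z $ i0) > \<psi> (zeta_part i0 (to_coords \<xi> W z))) \<and>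
      (z \<in> frontier D \<longleftrightarrow> Re (to_coords \<xi> W z $ i0) = \<psi> (zeta_part i0 (to_coords \<xi> W z)))"
    using assms(8) unfolding graph_neighbourhood_def Let_def by blast
  have \<xi>N: "\<xi> \<in> N" using V N closure_subset by blast
  \<comment> \<open>The image is a preimage under the continuous inverse map, hence open.\<close>
  have "to_coords \<xi> W ` N = from_coords \<xi> W -` N"
  proof (intro equalityI subsetI)
    fix w assume "w \<in> from_coords \<xi> W -` N"
    then show "w \<in> to_coords \<xi> W ` N"
      by (intro image_eqI[of _ _ "from_coords \<xi> W w"]) (simp_all add: to_coords_from_coords[OF W_frame(1)])
  qed (clarsimp simp: from_coords_to_coords[OF W_frame(1)])
  moreover have "continuous_on UNIV (from_coords \<xi> W)"
    unfolding from_coords_def[abs_def]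
    by (intro continuous_intros bounded_linear.continuous_on[OF bounded_linear_matrix_vector])
  ultimately have open_coords: "open (to_coords \<xi> W ` N)"
    using N(1) by (simp add: open_vimage)
  have zero: "0 \<in> to_coords \<xi> W ` N"
    using \<xi>N by (intro image_eqI[of _ _ \<xi>]) (auto simp: to_coords_def)
  have "zeta_part i0 0 = 0" by (simp add: zeta_part_def vec_eq_iff complex_eq_iff)
  then have \<psi>_zeta0: "\<psi> (zeta_part i0 0) = 0" using \<psi>0(1) by simp
  obtain G C \<delta> q where C: "C > 0" and \<delta>: "\<delta> > 0" and
    G: "\<And>x. norm x < \<delta> \<Longrightarrow> GDERIV (\<lambda>w. \<psi> (zeta_part i0 w)) x :> G x \<and> norm (G x) \<le> C * norm x" and
    q: "\<And>t x. q (t *\<^sub>R x) = t\<^sup>2 * q x"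
    "\<And>\<epsilon>. \<epsilon> > 0 \<Longrightarrow> \<exists>\<delta>>0. \<forall>x. norm x < \<delta> \<longrightarrow> \<bar>\<psi> (zeta_part i0 x) - q x\<bar> \<le> \<epsilon> * (norm x)\<^sup>2"
    by (rule C2_quadratic_approximation[OF C2 open_coords zero \<psi>0(2) \<psi>_zeta0]) blast
  obtain r1 where r1: "r1 > 0" "ball \<xi> r1 \<subseteq> V" using V openE by blast
  \<comment> \<open>The last bound gives C r \<le> 1/2.\<close>
  define r where "r = Min {\<delta>, r1, 1 / (2 * C)}"
  have r: "r > 0" "r \<le> \<delta>" "r \<le> r1" "r \<le> 1 / (2 * C)" using C \<delta> r1 by (auto simp: r_def)
  have Cr: "C * r < 1" using r(4) C by (simp add: field_simps)
  have near: "z \<in> N" if "dist z \<xi> < r" for z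
    using that r(3) r1(2) N(2) closure_subset by (fastforce simp: dist_commute)
  have zeta_idem: "zeta_part i0 (zeta_part i0 w) = zeta_part i0 w" for w
    by (simp add: zeta_part_def vec_eq_iff)
  interpret admissible_setting i0 \<psi> G C r q D V \<xi> W F f
  proof
    show "ball \<xi> r \<subseteq> V" using r(3) r1(2) by (auto simp: subset_iff)
    show "GDERIV (\<lambda>w. \<psi> (zeta_part i0 w)) w :> G w" "norm (G w) \<le> C * norm w"
      if "norm w < r" for w
      using G[of w] that r(2) by auto
    show "\<psi> (zeta_part i0 (zeta_part i0 w)) = \<psi> (zeta_part i0 w)" for w
      by (simp add: zeta_idem)
    show "z \<in> D \<longleftrightarrow> Re (to_coords \<xi> W z $ i0) > \<psi> (zeta_part i0 (to_coords \<xi> W z))"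
      "z \<in> frontier D \<longleftrightarrow> Re (to_coords \<xi> W z $ i0) = \<psi> (zeta_part i0 (to_coords \<xi> W z))"
      if "dist z \<xi> < r" for z
      using graph[OF near[OF that]] by auto
  qed (fact C r(1) \<psi>_zeta0 q W_frame(1) Cr assms)+
  \<comment> \<open>Both weights are put into one predicate, as in the two implications; the index
    \<open>i0\<close> is split off afterwards.\<close>
  define small where "small \<alpha> \<mu> \<longleftrightarrow>
    ((\<lambda>z. (if \<mu> = i0 then depth (coords z) else sqrt (depth (coords z))) * sderiv \<mu> z) \<longlongrightarrow> 0)
      (at \<xi> within region \<alpha>)" for \<alpha> \<mu>
  obtain L where L: "has_normal_limit f \<xi> \<nu> L" using assms(11) by blast
  have "(\<exists>L. has_admissible_limit i0 D \<xi> W \<psi> V f L) \<longleftrightarrow> (\<forall>\<alpha>>0. \<forall>\<mu>. small \<alpha> \<mu>)"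
    unfolding small_def
    using sderiv_tendsto admissible_limit_if_sderiv_tendsto[OF L W_frame(2)] by blast
  also have "\<dots> \<longleftrightarrow> (\<forall>\<alpha>>0. small \<alpha> i0 \<and> (\<forall>\<mu>. \<mu> \<noteq> i0 \<longrightarrow> small \<alpha> \<mu>))"
    by metis
  finally show ?thesis by (simp add: small_def boundary_d_eq)
qed

end
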